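(* Let $f:\hat{\mathbb{C}}\to\hat{\mathbb{C}}$ be a bicritical rational map of odd degree $d$. (1) $\mathrm{Deck}(f^k)\cong\mathbb{Z}_d$ for all $k\in\mathbb{N}$ if and only if $f$ is not a power map. (2) Furthermore, $f$ is a power map if and only if there exists $k\in\mathbb{N}$ such that $\mathrm{Deck}(f^k)\cong\mathbb{Z}_n$ for some $n>d$.
   Context: $\hat{\mathbb{C}}$ is the Riemann sphere, $\mathbb{N}=\{1,2,\dots\}$, and $f^k$ is the $k$-th iterate of $f$. For a rational map $f$, $\mathcal{C}_f$ is its set of critical points in $\hat{\mathbb{C}}$ and $\mathcal{V}_f=f(\mathcal{C}_f)$ its set of critical values. $f$ is bicritical if $|\mathcal{C}_f|=2$ (then $|\mathcal{V}_f|=2$ and $\deg f\ge 2$). A bicritical rational map $f$ is called a power map if $\mathcal{C}_f=\mathcal{V}_f$; equivalently, $f$ is conjugate by a Möbius transformation to $z\mapsto z^{d}$ or $z\mapsto z^{-d}$ for some $d\ge 2$. The deck group of a rational map $F$ is $\mathrm{Deck}(F)=\{\mu \text{ a Möbius transformation of } \hat{\mathbb{C}} : F\circ\mu=F\}$, a group under composition. $\mathbb{Z}_n$ is the cyclic group of order $n$. *)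

theory Defs
  imports
    "HOL-Analysis.Analysis"
    "HOL-Computational_Algebra.Polynomial_Factorial"
    "HOL-Computational_Algebra.Field_as_Ring"
    "HOL-Algebra.Elementary_Groups"
begin

datatype riemann_sphere = Fin complex | Infty

text \<open>
  The self-map of the sphere given by the quotient of two coprime polynomials. If \<open>n\<close> is the
  maximum of the degrees, the value at infinity is the quotient of the coefficients at \<open>n\<close>,
  which by coprimality do not both vanish.
\<close>

definition rational_fun :: "complex poly \<Rightarrow> complex poly \<Rightarrow> riemann_sphere \<Rightarrow> riemann_sphere" where
  "rational_fun p q x =
     (case x of
        Fin z \<Rightarrow> if poly q z = 0 then Infty else Fin (poly p z / poly q z)
      | Infty \<Rightarrow>
          (let n = max (degree p) (degree q)
           in if coeff q n = 0 then Infty else Fin (coeff p n / coeff q n)))"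

definition rational_map :: "(riemann_sphere \<Rightarrow> riemann_sphere) \<Rightarrow> bool" where
  "rational_map f \<longleftrightarrow> (\<exists>p q. coprime p q \<and> f = rational_fun p q)"

text \<open>
  The degree does not depend on the chosen coprime representation; see \<open>rational_degree_eq\<close> below.
\<close>

definition rational_degree :: "(riemann_sphere \<Rightarrow> riemann_sphere) \<Rightarrow> nat" where
  "rational_degree f =
     (THE d. \<exists>p q. coprime p q \<and> f = rational_fun p q \<and> d = max (degree p) (degree q))"

definition moebius_map :: "(riemann_sphere \<Rightarrow> riemann_sphere) \<Rightarrow> bool" where
  "moebius_map \<mu> \<longleftrightarrow> (\<exists>a b c d. a * d - b * c \<noteq> 0 \<and> \<mu> = rational_fun [:b, a:] [:d, c:])"

text \<open>
  The standard atlas: \<open>chart x\<close> is the coordinate \<open>z\<close> if \<open>x\<close> is finite and \<open>1 / z\<close> if \<open>x\<close> is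
  infinity, and \<open>chart_inv x\<close> is its inverse. The one point outside the domain of \<open>chart x\<close>
  is sent to the dummy value \<open>0\<close>, which does not matter for derivatives at \<open>x\<close>.
\<close>

definition chart :: "riemann_sphere \<Rightarrow> riemann_sphere \<Rightarrow> complex" where
  "chart x y =
     (case x of
        Fin _ \<Rightarrow> (case y of Fin z \<Rightarrow> z | Infty \<Rightarrow> 0)
      | Infty \<Rightarrow> (case y of Fin z \<Rightarrow> inverse z | Infty \<Rightarrow> 0))"

definition chart_inv :: "riemann_sphere \<Rightarrow> complex \<Rightarrow> riemann_sphere" where
  "chart_inv x w =
     (case x of
        Fin _ \<Rightarrow> Fin w
      | Infty \<Rightarrow> (if w = 0 then Infty else Fin (inverse w)))"

definition critical_points :: "(riemann_sphere \<Rightarrow> riemann_sphere) \<Rightarrow> riemann_sphere set" where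
  "critical_points f =
     {x. ((chart (f x) \<circ> f \<circ> chart_inv x) has_field_derivative 0) (at (chart x x))}"

definition critical_values :: "(riemann_sphere \<Rightarrow> riemann_sphere) \<Rightarrow> riemann_sphere set" where
  "critical_values f = f ` critical_points f"

definition bicritical :: "(riemann_sphere \<Rightarrow> riemann_sphere) \<Rightarrow> bool" where
  "bicritical f \<longleftrightarrow> rational_map f \<and> card (critical_points f) = 2"

definition power_map :: "(riemann_sphere \<Rightarrow> riemann_sphere) \<Rightarrow> bool" where
  "power_map f \<longleftrightarrow> bicritical f \<and> critical_points f = critical_values f"

definition Deck :: "(riemann_sphere \<Rightarrow> riemann_sphere) \<Rightarrow> (riemann_sphere \<Rightarrow> riemann_sphere) monoid" where
  "Deck F = \<lparr>carrier = {\<mu>. moebius_map \<mu> \<and> F \<circ> \<mu> = F}, mult = (\<circ>), one = id\<rparr>"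

lemma rational_fun_cross_eq:
  assumes "coprime p q" "coprime p' q'" "rational_fun p q = rational_fun p' q'"
  shows "p * q' = p' * q"
proof -
  have "poly (p * q' - p' * q) z = 0" for z
  proof -
    have "rational_fun p q (Fin z) = rational_fun p' q' (Fin z)"
      using assms by simp
    then show ?thesis
      by (auto simp: rational_fun_def field_simps split: if_splits)
  qed
  then have "p * q' - p' * q = 0"
    using poly_all_0_iff_0 by blast
  then show ?thesis by simp
qed

lemma rational_degree_eq:
  assumes "coprime p q"
  shows "rational_degree (rational_fun p q) = max (degree p) (degree q)"
  unfolding rational_degree_def
proof (rule the_equality)
  show "\<exists>p' q'. coprime p' q' \<and> rational_fun p q = rational_fun p' q' \<and>
          max (degree p) (degree q) = max (degree p') (degree q')"
    using assms by blast
next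
  fix d
  assume "\<exists>p' q'. coprime p' q' \<and> rational_fun p q = rational_fun p' q' \<and>
            d = max (degree p') (degree q')"
  then obtain p' q' where *: "coprime p' q'" "rational_fun p q = rational_fun p' q'"
    and d: "d = max (degree p') (degree q')" by blast
  have cross: "p * q' = p' * q"
    using rational_fun_cross_eq assms * by blast
  have same_degree: "degree r = degree s" if "r dvd s" "s dvd r" for r s :: "complex poly"
  proof (cases "r = 0")
    case True
    then show ?thesis using that by simp
  next
    case False
    then have "s \<noteq> 0" using that by auto
    with False show ?thesis using that by (intro antisym dvd_imp_degree_le)
  qed
  have "p dvd p' * q" "p' dvd p * q'" "q dvd p * q'" "q' dvd p' * q"
    using cross by (metis dvd_triv_left dvd_triv_right)+
  then have "p dvd p'" "p' dvd p" "q dvd q'" "q' dvd q"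
    using assms *(1) coprime_dvd_mult_left_iff[of p q p'] coprime_dvd_mult_left_iff[of p' q' p]
      coprime_dvd_mult_right_iff[of q p q'] coprime_dvd_mult_right_iff[of q' p' q]
    by (simp_all add: coprime_commute)
  then have "degree p = degree p'" "degree q = degree q'"
    using same_degree by blast+
  then show "d = max (degree p) (degree q)" using d by simp
qed

end

theory Submission
  imports
    Defs
    "HOL-Algebra.Group_Action"
    "HOL-Computational_Algebra.Fundamental_Theorem_Algebra"
begin

text \<open>
  A Riemann-Hurwitz count, carried out with the Wronskian \<open>p' q - p q'\<close>, shows that both critical
  points of a bicritical map of degree \<open>d\<close> are fully ramified. Hence
  \<open>f = M \<circ> (z \<mapsto> z\<^sup>d) \<circ> N\<close> with Moebius maps \<open>M\<close>, \<open>N\<close>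
  (\<open>bicritical_normal_form\<close>). Conjugating by \<open>N\<close>, one may replace \<open>f\<close> by
  \<open>g = h \<circ> (z \<mapsto> z\<^sup>d)\<close>, where \<open>h = N \<circ> M\<close>. Its critical points are \<open>0\<close> and \<open>\<infinity>\<close>,
  its critical values are \<open>h 0\<close> and \<open>h \<infinity>\<close>, and \<open>f\<close> is a power map exactly if \<open>h\<close>
  preserves the set \<open>{0, \<infinity>}\<close>. The deck group of \<open>g\<close> consists of the rotations
  \<open>z \<mapsto> a z\<close> with \<open>a\<^sup>d = 1\<close> and is cyclic of order \<open>d\<close>.

  If \<open>h\<close> preserves \<open>{0, \<infinity>}\<close>, then \<open>g \<circ> g\<close> is a Moebius map after
  \<open>z \<mapsto> z ^ (d * d)\<close>, so its deck group is cyclic of order \<open>d\<^sup>2 > d\<close>.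

  Suppose that \<open>h\<close> does not preserve \<open>{0, \<infinity>}\<close>. Outside a finite set of points every fibre of
  \<open>g ^^ k\<close> has \<open>d ^ k\<close> points, and a deck group acts freely on all but finitely many fibres.
  Therefore \<open>Deck (g ^^ k)\<close> is finite of an order dividing \<open>d ^ k\<close>; this is where the parity of
  \<open>d\<close> enters, because now the order is odd. In a finite Moebius group of odd order a point that is
  fixed by one nontrivial element is fixed by all of them
  (\<open>odd_moebius_group_fixes_special_point\<close>): counting orbits with Burnside's lemma leaves no
  room for stabilisers of order at least three in more than two orbits. The rotations in \<open>Deck g\<close>
  belong to \<open>Deck (g ^^ k)\<close> and fix \<open>0\<close> and \<open>\<infinity>\<close>, so every element of
  \<open>Deck (g ^^ k)\<close> is a rotation \<open>\<mu>\<close> about \<open>0\<close> and \<open>\<infinity>\<close>. Now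
  \<open>g \<circ> \<mu> = \<nu> \<circ> g\<close> for a Moebius map \<open>\<nu>\<close> that fixes \<open>h 0\<close> and \<open>h \<infinity>\<close>
  and belongs to \<open>Deck (g ^^ (k - 1))\<close>. By induction \<open>\<nu>\<close> also fixes \<open>0\<close> and \<open>\<infinity>\<close>.
  These are at least three points, so \<open>\<nu>\<close> is the identity and \<open>\<mu>\<close> lies in \<open>Deck g\<close>.
\<close>

section \<open>Moebius maps in homogeneous coordinates\<close>

text \<open>
  The point \<open>[u : v]\<close> of the projective line, for \<open>(u, v) \<noteq> (0, 0)\<close>.
\<close>

definition proj :: "complex \<Rightarrow> complex \<Rightarrow> riemann_sphere" where
  "proj u v = (if v = 0 then Infty else Fin (u / v))"

definition moeb :: "complex \<Rightarrow> complex \<Rightarrow> complex \<Rightarrow> complex \<Rightarrow> riemann_sphere \<Rightarrow> riemann_sphere" where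
  "moeb a b c d x = (case x of Fin z \<Rightarrow> proj (a * z + b) (c * z + d) | Infty \<Rightarrow> proj a c)"

lemma proj_cases:
  obtains u v where "x = proj u v" "u \<noteq> 0 \<or> v \<noteq> 0"
proof (cases x)
  case (Fin z)
  then show ?thesis using that[of z 1] by (simp add: proj_def)
next
  case Infty
  then show ?thesis using that[of 1 0] by (simp add: proj_def)
qed

lemma nonsingular_apply:
  fixes a b c d u v :: complex
  assumes "a * d - b * c \<noteq> 0" "u \<noteq> 0 \<or> v \<noteq> 0"
  shows "a * u + b * v \<noteq> 0 \<or> c * u + d * v \<noteq> 0"
proof (rule ccontr)
  assume "\<not> ?thesis"
  then have *: "a * u + b * v = 0" "c * u + d * v = 0" by auto
  have "(a * d - b * c) * u = d * (a * u + b * v) - b * (c * u + d * v)"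
       "(a * d - b * c) * v = a * (c * u + d * v) - c * (a * u + b * v)"
    by (simp_all add: algebra_simps)
  then show False using * assms by simp
qed

text \<open>
  On homogeneous coordinates the map is multiplication by the matrix with rows \<open>(a, b)\<close> and
  \<open>(c, d)\<close>. Computing there avoids all case distinctions at infinity, and composition becomes the
  product of matrices.
\<close>

lemma moeb_proj:
  assumes "a * d - b * c \<noteq> 0" "u \<noteq> 0 \<or> v \<noteq> 0"
  shows "moeb a b c d (proj u v) = proj (a * u + b * v) (c * u + d * v)"
proof (cases "v = 0")
  case True
  then show ?thesis using assms by (auto simp: moeb_def proj_def)
next
  case False
  have eqs: "c * (u / v) + d = (c * u + d * v) / v" "a * (u / v) + b = (a * u + b * v) / v"
    using False by (simp_all add: add_divide_distrib)
  have "moeb a b c d (proj u v) = proj (a * (u / v) + b) (c * (u / v) + d)"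
    using False by (simp add: moeb_def proj_def[of u])
  also have "\<dots> = proj ((a * u + b * v) / v) ((c * u + d * v) / v)"
    unfolding eqs ..
  also have "\<dots> = proj (a * u + b * v) (c * u + d * v)"
  proof -
    have "proj (s / v) (t / v) = proj s t" for s t
      using False by (simp add: proj_def)
    then show ?thesis .
  qed
  finally show ?thesis .
qed

lemma rational_fun_linear_eq_moeb:
  assumes "a * d - b * c \<noteq> 0"
  shows "rational_fun [:b, a:] [:d, c:] = moeb a b c d"
proof
  fix x
  show "rational_fun [:b, a:] [:d, c:] x = moeb a b c d x"
    using assms by (cases x) (auto simp: rational_fun_def moeb_def proj_def Let_def algebra_simps)
qed

lemma moebius_map_iff:
  "moebius_map \<mu> \<longleftrightarrow> (\<exists>a b c d. a * d - b * c \<noteq> 0 \<and> \<mu> = moeb a b c d)"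
proof -
  have "a * d - b * c \<noteq> 0 \<and> \<mu> = rational_fun [:b, a:] [:d, c:] \<longleftrightarrow>
        a * d - b * c \<noteq> 0 \<and> \<mu> = moeb a b c d" for a b c d
    by (cases "a * d - b * c = 0") (simp_all only: rational_fun_linear_eq_moeb simp_thms)
  then show ?thesis unfolding moebius_map_def by simp
qed

lemma moeb_comp:
  assumes "a * d - b * c \<noteq> 0" "a' * d' - b' * c' \<noteq> 0"
  shows "moeb a b c d \<circ> moeb a' b' c' d' =
    moeb (a * a' + b * c') (a * b' + b * d') (c * a' + d * c') (c * b' + d * d')"
    and "(a * a' + b * c') * (c * b' + d * d') - (a * b' + b * d') * (c * a' + d * c') \<noteq> 0"
proof -
  have eq: "(a * a' + b * c') * (c * b' + d * d') - (a * b' + b * d') * (c * a' + d * c')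
      = (a * d - b * c) * (a' * d' - b' * c')"
    by (simp add: algebra_simps)
  with assms show det: "(a * a' + b * c') * (c * b' + d * d') - (a * b' + b * d') * (c * a' + d * c') \<noteq> 0"
    by simp
  show "moeb a b c d \<circ> moeb a' b' c' d' =
    moeb (a * a' + b * c') (a * b' + b * d') (c * a' + d * c') (c * b' + d * d')"
  proof
    fix x
    obtain u v where x: "x = proj u v" "u \<noteq> 0 \<or> v \<noteq> 0" by (rule proj_cases)
    then show "(moeb a b c d \<circ> moeb a' b' c' d') x =
      moeb (a * a' + b * c') (a * b' + b * d') (c * a' + d * c') (c * b' + d * d') x"
      using nonsingular_apply[OF assms(2) x(2)]
      by (simp only: x(1) comp_apply moeb_proj[OF assms(2)] moeb_proj[OF assms(1)] moeb_proj[OF det])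
        (simp add: algebra_simps)
  qed
qed

lemma moeb_scalar: "a \<noteq> 0 \<Longrightarrow> moeb a 0 0 a = id"
  by (rule ext) (auto simp: moeb_def proj_def split: riemann_sphere.split)

lemma moebius_moeb: "a * d - b * c \<noteq> 0 \<Longrightarrow> moebius_map (moeb a b c d)"
  unfolding moebius_map_iff by blast

lemma moebius_id: "moebius_map id"
  using moebius_moeb[of 1 1 0 0] moeb_scalar[of 1] by simp

lemma moebius_comp:
  assumes "moebius_map \<mu>" "moebius_map \<nu>"
  shows "moebius_map (\<mu> \<circ> \<nu>)"
proof -
  obtain a b c d a' b' c' d' where 1: "a * d - b * c \<noteq> 0" "\<mu> = moeb a b c d"
    and 2: "a' * d' - b' * c' \<noteq> 0" "\<nu> = moeb a' b' c' d'"
    using assms unfolding moebius_map_iff by blast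
  show ?thesis
    using moebius_moeb[OF moeb_comp(2)[OF 1(1) 2(1)]] by (simp add: moeb_comp(1)[OF 1(1) 2(1)] 1(2) 2(2))
qed

lemma moebius_inverse:
  assumes "moebius_map \<mu>"
  obtains \<nu> where "moebius_map \<nu>" "\<mu> \<circ> \<nu> = id" "\<nu> \<circ> \<mu> = id"
proof -
  obtain a b c d where *: "a * d - b * c \<noteq> 0" "\<mu> = moeb a b c d"
    using assms moebius_map_iff by blast
  have adj: "d * a - (- b) * (- c) \<noteq> 0" using * by (simp add: algebra_simps)
  have "moebius_map (moeb d (- b) (- c) a)"
    using adj moebius_map_iff by blast
  moreover have "\<mu> \<circ> moeb d (- b) (- c) a = id" "moeb d (- b) (- c) a \<circ> \<mu> = id"
    using moeb_comp(1)[OF *(1) adj] moeb_comp(1)[OF adj *(1)] moeb_scalar[of "a * d - b * c"] * 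
    by (simp_all add: algebra_simps)
  ultimately show ?thesis using that by blast
qed

lemma moebius_bij: "moebius_map \<mu> \<Longrightarrow> bij \<mu>"
  by (metis moebius_inverse o_bij)

lemma moeb_fixed_Fin:
  assumes "a * d - b * c \<noteq> 0"
  shows "moeb a b c d (Fin z) = Fin z \<longleftrightarrow> c * z\<^sup>2 + (d - a) * z - b = 0"
proof -
  have "c * z + d = 0 \<Longrightarrow> c * z\<^sup>2 + (d - a) * z - b = 0 \<Longrightarrow> False"
  proof -
    assume 1: "c * z + d = 0" "c * z\<^sup>2 + (d - a) * z - b = 0"
    have "c * z\<^sup>2 + (d - a) * z - b = z * (c * z + d) - (a * z + b)"
      by (simp add: algebra_simps power2_eq_square)
    then have "- (a * z + b) = 0" unfolding 1 by simp
    then have "a * z + b = 0" unfolding neg_equal_0_iff_equal .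
    then show False using nonsingular_apply[OF assms, of z 1] 1 by simp
  qed
  then show ?thesis
    by (auto simp: moeb_def proj_def field_simps power2_eq_square)
qed

lemma moeb_fixed_Infty:
  assumes "a * d - b * c \<noteq> 0"
  shows "moeb a b c d Infty = Infty \<longleftrightarrow> c = 0"
  by (auto simp: moeb_def proj_def)

lemma quadratic_three_roots:
  fixes a b c :: complex
  assumes "distinct [x, y, z]"
    and "a * x\<^sup>2 + b * x + c = 0" "a * y\<^sup>2 + b * y + c = 0" "a * z\<^sup>2 + b * z + c = 0"
  shows "a = 0 \<and> b = 0 \<and> c = 0"
proof -
  have "(x - y) * (a * (x + y) + b) = (a * x\<^sup>2 + b * x + c) - (a * y\<^sup>2 + b * y + c)"
       "(x - z) * (a * (x + z) + b) = (a * x\<^sup>2 + b * x + c) - (a * z\<^sup>2 + b * z + c)"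
    by (simp_all add: algebra_simps power2_eq_square)
  then have *: "a * (x + y) + b = 0" "a * (x + z) + b = 0"
    using assms by auto
  have "a * (y - z) = (a * (x + y) + b) - (a * (x + z) + b)" by (simp add: algebra_simps)
  then have "a * (y - z) = 0" using * by simp
  then have "a = 0" using assms by simp
  with * assms show ?thesis by simp
qed

text \<open>
  The finite fixed points are the roots of \<open>c z\<^sup>2 + (d - a) z - b\<close>, and infinity is fixed if
  \<open>c = 0\<close>, when this polynomial has degree at most one. Three fixed points force all its
  coefficients to vanish, so the matrix is scalar.
\<close>

lemma moebius_three_fixed_points:
  assumes "moebius_map \<mu>" "distinct [x, y, z]" "\<mu> x = x" "\<mu> y = y" "\<mu> z = z"
  shows "\<mu> = id"
proof -
  obtain a b c d where *: "a * d - b * c \<noteq> 0" "\<mu> = moeb a b c d"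
    using assms moebius_map_iff by blast
  have scalar: "\<mu> = id" if "a = d" "b = 0" "c = 0"
    using that * moeb_scalar[of a] by auto
  have inf: "\<mu> = id" if "s \<noteq> t" "\<mu> (Fin s) = Fin s" "\<mu> (Fin t) = Fin t" "\<mu> Infty = Infty" for s t
  proof -
    have "c = 0" using that * moeb_fixed_Infty by blast
    then have 1: "(d - a) * s - b = 0" "(d - a) * t - b = 0"
      using that * moeb_fixed_Fin[OF *(1)] by auto
    then have "(d - a) * (s - t) = 0" by (simp add: algebra_simps)
    then have "a = d" using that by simp
    then show ?thesis using 1 \<open>c = 0\<close> scalar by simp
  qed
  show ?thesis
  proof (cases "Infty \<in> {x, y, z}")
    case True
    then consider "x = Infty" | "y = Infty" | "z = Infty" by blast
    then show ?thesis
    proof cases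
      case 1
      then obtain s t where "y = Fin s" "z = Fin t"
        using assms(2) by (cases y; cases z) auto
      then show ?thesis using assms(2-5) 1 inf[of s t] by simp
    next
      case 2
      then obtain s t where "x = Fin s" "z = Fin t"
        using assms(2) by (cases x; cases z) auto
      then show ?thesis using assms(2-5) 2 inf[of s t] by simp
    next
      case 3
      then obtain s t where "x = Fin s" "y = Fin t"
        using assms(2) by (cases x; cases y) auto
      then show ?thesis using assms(2-5) 3 inf[of s t] by simp
    qed
  next
    case False
    then obtain r s t where "x = Fin r" "y = Fin s" "z = Fin t"
      by (metis insertCI riemann_sphere.exhaust)
    then have "c = 0 \<and> d - a = 0 \<and> - b = 0"
      using assms * moeb_fixed_Fin[OF *(1)]
      by (intro quadratic_three_roots[of r s t]) auto
    then show ?thesis using scalar by auto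
  qed
qed

lemma moebius_fixed_point_exists:
  assumes "moebius_map \<mu>"
  obtains x where "\<mu> x = x"
proof -
  obtain a b c d where *: "a * d - b * c \<noteq> 0" "\<mu> = moeb a b c d"
    using assms moebius_map_iff by blast
  show ?thesis
  proof (cases "c = 0")
    case True
    then show ?thesis using that * moeb_fixed_Infty by blast
  next
    case False
    define s where "s = csqrt ((d - a)\<^sup>2 + 4 * b * c)"
    define z where "z = (a - d + s) / (2 * c)"
    have s: "s\<^sup>2 = (d - a)\<^sup>2 + 4 * b * c" by (simp add: s_def)
    have 2: "2 * c * z = a - d + s" using False by (simp add: z_def)
    have "4 * c * (c * z\<^sup>2 + (d - a) * z - b) = (2 * c * z)\<^sup>2 + 2 * (d - a) * (2 * c * z) - 4 * b * c"
      by (simp add: algebra_simps power2_eq_square)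
    also have "\<dots> = s\<^sup>2 - (d - a)\<^sup>2 - 4 * b * c"
      unfolding 2 by (simp add: algebra_simps power2_eq_square)
    finally have "c * z\<^sup>2 + (d - a) * z - b = 0" using s False by simp
    then show ?thesis using that[of "Fin z"] moeb_fixed_Fin[OF *(1)] * by blast
  qed
qed

lemma moebius_moves_Infty_to:
  obtains h where "moebius_map h" "h Infty = x"
proof (cases x)
  case Infty
  then show ?thesis using that[of id] moebius_id by simp
next
  case (Fin w)
  have "moebius_map (moeb w 1 1 0)" unfolding moebius_map_iff
    by (intro exI[of _ w] exI[of _ 1] exI[of _ 1] exI[of _ 0]) simp
  then show ?thesis using that[of "moeb w 1 1 0"] Fin by (simp add: moeb_def proj_def)
qed

lemma conj_funpow:
  assumes "h \<circ> h' = id" 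
  shows "(h' \<circ> f \<circ> h) ^^ n \<circ> h' = h' \<circ> f ^^ n"
proof (induction n)
  case (Suc n)
  have "(h' \<circ> f \<circ> h) ^^ Suc n \<circ> h' = (h' \<circ> f \<circ> h) \<circ> ((h' \<circ> f \<circ> h) ^^ n \<circ> h')"
    by (simp only: funpow.simps o_assoc)
  also have "\<dots> = (h' \<circ> f) \<circ> (h \<circ> h') \<circ> f ^^ n"
    unfolding Suc by (simp only: o_assoc)
  finally show ?case using assms by (simp only: funpow.simps o_assoc comp_id)
qed simp

text \<open>
  A Moebius map that fixes infinity is affine. If its linear coefficient is \<open>1\<close>, it is a translation,
  and a nonzero translation has infinite order; otherwise it has a finite fixed point.
\<close>

lemma finite_order_moebius_fixing_Infty:
  assumes "moebius_map \<mu>" "\<mu> \<noteq> id" "\<mu> ^^ n = id" "n > 0" "\<mu> Infty = Infty"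
  obtains z where "\<mu> (Fin z) = Fin z"
proof -
  obtain a b c d where *: "a * d - b * c \<noteq> 0" "\<mu> = moeb a b c d"
    using assms moebius_map_iff by blast
  have c: "c = 0" using assms * moeb_fixed_Infty by blast
  have "a \<noteq> d"
  proof
    assume "a = d"
    then have "a \<noteq> 0" using * c by auto
    have step: "\<mu> (Fin z) = Fin (z + b / a)" for z
    proof -
      have "(a * z + b) / a = z + b / a" using \<open>a \<noteq> 0\<close> by (simp add: add_divide_distrib)
      then show ?thesis using \<open>a \<noteq> 0\<close> unfolding *(2) c \<open>a = d\<close>[symmetric]
        by (simp add: moeb_def proj_def)
    qed
    have "(\<mu> ^^ m) (Fin 0) = Fin (of_nat m * (b / a))" for m
      by (induction m) (simp_all add: step distrib_right add.commute del: times_divide_eq_right)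
    from this[of n] assms have "of_nat n * (b / a) = 0" by simp
    then have "b = 0" using \<open>a \<noteq> 0\<close> assms(4) by simp
    then have "\<mu> = id" using moeb_scalar[of a] * c \<open>a = d\<close> \<open>a \<noteq> 0\<close> by simp
    then show False using assms by blast
  qed
  then have "c * (b / (d - a))\<^sup>2 + (d - a) * (b / (d - a)) - b = 0"
    using c by simp
  then have "\<mu> (Fin (b / (d - a))) = Fin (b / (d - a))"
    unfolding *(2) moeb_fixed_Fin[OF *(1)] .
  then show ?thesis using that by blast
qed

text \<open>
  Only parabolic maps have a single fixed point, and these have infinite order: moving a fixed point
  to infinity turns them into translations.
\<close>

lemma finite_order_moebius_fixed_points:
  assumes "moebius_map \<mu>" "\<mu> \<noteq> id" "\<mu> ^^ n = id" "n > 0"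
  shows "card {x. \<mu> x = x} = 2"
proof -
  obtain x where x: "\<mu> x = x" using moebius_fixed_point_exists assms by blast
  obtain h where h: "moebius_map h" "h Infty = x" by (rule moebius_moves_Infty_to)
  obtain h' where h': "moebius_map h'" "h \<circ> h' = id" "h' \<circ> h = id"
    using moebius_inverse h by blast
  have hh: "h (h' t) = t" "h' (h t) = t" for t
    using h' by (simp_all add: fun_eq_iff)
  define \<nu> where "\<nu> = h' \<circ> \<mu> \<circ> h"
  have \<nu>: "moebius_map \<nu>" unfolding \<nu>_def using assms h h' moebius_comp by blast
  have mu_eq: "\<mu> = h \<circ> \<nu> \<circ> h'" by (rule ext) (simp add: \<nu>_def hh)
  have "\<nu> \<noteq> id" using assms(2) mu_eq h' by auto
  moreover have "\<nu> ^^ n = id"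
  proof
    fix t
    have "(\<nu> ^^ n \<circ> h') (h t) = (h' \<circ> \<mu> ^^ n) (h t)"
      using conj_funpow[OF h'(2), where f = \<mu> and n = n] by (simp add: \<nu>_def)
    then show "(\<nu> ^^ n) t = id t" using assms(3) by (simp add: hh)
  qed
  moreover have "\<nu> Infty = Infty" using x h hh by (metis \<nu>_def comp_apply)
  ultimately obtain z where z: "\<nu> (Fin z) = Fin z"
    using finite_order_moebius_fixing_Infty \<nu> assms(4) by metis
  have y: "\<mu> (h (Fin z)) = h (Fin z)" using z mu_eq hh by simp
  have "h (Fin z) \<noteq> x" using h hh by (metis riemann_sphere.distinct(1))
  then have "{x. \<mu> x = x} = {x, h (Fin z)}"
    using x y moebius_three_fixed_points[OF assms(1), of x "h (Fin z)"] assms(2) by fastforce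
  then show ?thesis using \<open>h (Fin z) \<noteq> x\<close> by simp
qed

section \<open>Groups of maps under composition and odd Moebius groups\<close>

text \<open>
  Deck groups have this form. Keeping the set of maps as a parameter separates the counting arguments,
  which hold for any group of maps, from the equation that defines a deck transformation.
\<close>

abbreviation comp_group :: "('a \<Rightarrow> 'a) set \<Rightarrow> ('a \<Rightarrow> 'a) monoid" where
  "comp_group H \<equiv> \<lparr>carrier = H, mult = (\<circ>), one = id\<rparr>"

lemma comp_group_inverse:
  assumes "group (comp_group H)" "g \<in> H"
  obtains h where "h \<in> H" "h \<circ> g = id" "g \<circ> h = id"
proof -
  interpret group "comp_group H" by fact
  have "inv\<^bsub>comp_group H\<^esub> g \<in> H" "inv\<^bsub>comp_group H\<^esub> g \<circ> g = id" "g \<circ> inv\<^bsub>comp_group H\<^esub> g = id"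
    using inv_closed[of g] l_inv[of g] r_inv[of g] assms(2) by simp_all
  then show ?thesis using that by blast
qed

lemma comp_group_closed:
  assumes "group (comp_group H)"
  shows "id \<in> H" "g \<in> H \<Longrightarrow> h \<in> H \<Longrightarrow> g \<circ> h \<in> H"
proof -
  interpret group "comp_group H" by fact
  show "id \<in> H" "g \<in> H \<Longrightarrow> h \<in> H \<Longrightarrow> g \<circ> h \<in> H"
    using one_closed m_closed[of g h] by simp_all
qed

text \<open>
  By the pigeonhole principle two powers of \<open>g\<close> agree, and \<open>g\<close> is injective, so the smaller power
  can be cancelled.
\<close>

lemma comp_group_finite_order:
  assumes "group (comp_group H)" "finite H" "g \<in> H"
  obtains n where "n > 0" "g ^^ n = id"
proof -
  have "g ^^ n \<in> H" for n
  proof (induction n)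
    case 0
    show ?case using comp_group_closed(1)[OF assms(1)] by (simp only: funpow.simps)
  next
    case (Suc n)
    show ?case using comp_group_closed(2)[OF assms(1,3) Suc] by (simp only: funpow.simps)
  qed
  then have "range (\<lambda>n. g ^^ n) \<subseteq> H" by (rule image_subsetI)
  then have "finite (range (\<lambda>n. g ^^ n))" using assms(2) by (rule finite_subset)
  then have "\<not> inj (\<lambda>n. g ^^ n)" using finite_imageD[of "\<lambda>n. g ^^ n" "UNIV :: nat set"] by auto
  then obtain i j where "i < j" and eq: "g ^^ i = g ^^ j"
    unfolding inj_def by (metis linorder_neqE_nat)
  obtain h where "h \<in> H" "h \<circ> g = id" "g \<circ> h = id" using assms(1,3) by (rule comp_group_inverse)
  then have "inj g" by (metis inj_on_id inj_on_imageI2)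
  then have "inj (g ^^ i)" by (rule inj_fn)
  moreover have "(g ^^ i) ((g ^^ (j - i)) x) = (g ^^ i) x" for x
    using \<open>i < j\<close> fun_cong[OF funpow_add[of i "j - i" g], of x] by (simp add: eq)
  ultimately have "g ^^ (j - i) = id" by (simp add: inj_eq fun_eq_iff)
  then show ?thesis using that[of "j - i"] \<open>i < j\<close> by simp
qed

lemma comp_group_action:
  assumes "group (comp_group H)" and inv: "\<And>g x. g \<in> H \<Longrightarrow> x \<in> E \<Longrightarrow> g x \<in> E"
  shows "group_action (comp_group H) E (\<lambda>g. restrict g E)"
proof -
  have bij: "restrict g E \<in> Bij E" if g: "g \<in> H" for g
  proof -
    obtain h where h: "h \<in> H" "h \<circ> g = id" "g \<circ> h = id"
      using comp_group_inverse assms(1) g by blast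
    have "bij_betw g E E"
      using h inv g by (intro bij_betwI[of g E E h]) (auto simp: fun_eq_iff)
    then show ?thesis by (simp add: Bij_def cong: bij_betw_cong)
  qed
  have "(\<lambda>g. restrict g E) \<in> hom (comp_group H) (BijGroup E)"
  proof (rule homI)
    fix g h assume "g \<in> carrier (comp_group H)" "h \<in> carrier (comp_group H)"
    then show "restrict (g \<otimes>\<^bsub>comp_group H\<^esub> h) E = restrict g E \<otimes>\<^bsub>BijGroup E\<^esub> restrict h E"
      using bij inv by (auto simp: BijGroup_def compose_def fun_eq_iff)
  qed (auto simp: BijGroup_def bij)
  then show ?thesis
    unfolding group_action_def group_hom_def group_hom_axioms_def
    using assms(1) group_BijGroup by blast
qed

lemma comp_group_orbit_stabilizer:
  assumes "group (comp_group H)"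
  shows "card ((\<lambda>g. g x) ` H) * card {g \<in> H. g x = x} = card H"
proof -
  interpret group_action "comp_group H" UNIV "\<lambda>g. restrict g UNIV"
    by (rule comp_group_action[OF assms]) simp
  show ?thesis
    using orbit_stabilizer_theorem[of x]
    by (simp add: orbit_def stabilizer_def Coset.order_def Setcompr_eq_image)
qed

text \<open>
  Burnside's lemma with the contribution of the identity, which fixes all of \<open>E\<close>, split off.
\<close>

lemma comp_group_burnside:
  assumes "group (comp_group H)" "finite H" "finite E"
    and inv: "\<And>g x. g \<in> H \<Longrightarrow> x \<in> E \<Longrightarrow> g x \<in> E"
  shows "card ((\<lambda>x. (\<lambda>g. g x) ` H) ` E) * card H = card E + (\<Sum>g\<in>H - {id}. card {x \<in> E. g x = x})"
proof -
  interpret group_action "comp_group H" E "\<lambda>g. restrict g E"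
    using comp_group_action assms by blast
  have orb: "orbit (comp_group H) (\<lambda>g. restrict g E) x = (\<lambda>g. g x) ` H" if "x \<in> E" for x
    using that by (auto simp: orbit_def)
  have orbs: "orbits (comp_group H) E (\<lambda>g. restrict g E) = (\<lambda>x. (\<lambda>g. g x) ` H) ` E"
    unfolding orbits_def using orb by (auto simp: image_iff)
  have fixed: "invariants E (\<lambda>g. restrict g E) g = {x \<in> E. g x = x}" for g
    by (auto simp: invariants_def)
  have "card ((\<lambda>x. (\<lambda>g. g x) ` H) ` E) * card H = (\<Sum>g\<in>H. card {x \<in> E. g x = x})"
    using burnside assms(2,3) by (simp add: orbs fixed Coset.order_def)
  also have "\<dots> = card {x \<in> E. id x = x} + (\<Sum>g\<in>H - {id}. card {x \<in> E. g x = x})"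
    by (rule sum.remove) (use assms comp_group_closed(1) in blast)+
  finally show ?thesis by simp
qed

text \<open>
  Let \<open>N\<close> be the order of the group and \<open>S\<close> the finite set of points with nontrivial stabiliser,
  and let \<open>r\<close> be the number of orbits in \<open>S\<close>. Each of the \<open>N - 1\<close> nontrivial elements has two
  fixed points, so Burnside's lemma gives \<open>r N = |S| + 2 (N - 1)\<close>. Stabilisers of points of \<open>S\<close>
  have odd order greater than one, hence order at least three; so each orbit has at most \<open>N / 3\<close>
  points and \<open>3 |S| \<le> r N\<close>. Together these give \<open>r < 3\<close>, then \<open>r = 2 = |S|\<close>: the
  orbits in \<open>S\<close> are single points.
\<close>

lemma odd_moebius_group_fixes_special_point:
  assumes H: "group (comp_group H)" "finite H" "odd (card H)" and moeb: "\<And>g. g \<in> H \<Longrightarrow> moebius_map g"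
    and x: "g0 \<in> H" "g0 \<noteq> id" "g0 x = x" and g: "g \<in> H"
  shows "g x = x"
proof -
  define N where "N = card H"
  define S where "S = {y. \<exists>h\<in>H - {id}. h y = y}"
  define orb where "orb y = (\<lambda>h. h y) ` H" for y :: riemann_sphere
  define r where "r = card (orb ` S)"
  have two: "card {y. h y = y} = 2" if h: "h \<in> H - {id}" for h
  proof -
    obtain m where "m > 0" "h ^^ m = id" using comp_group_finite_order[OF H(1,2)] h by blast
    then show ?thesis using h moeb by (intro finite_order_moebius_fixed_points[of h m]) auto
  qed
  have "S = (\<Union>h\<in>H - {id}. {y. h y = y})" by (auto simp: S_def)
  moreover have "finite {y. h y = y}" if "h \<in> H - {id}" for h
    using two[OF that] by (metis card.infinite zero_neq_numeral)
  ultimately have finS: "finite S" using H(2) by auto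
  have inv: "h y \<in> S" if hy: "h \<in> H" "y \<in> S" for h y
  proof -
    obtain k where k: "k \<in> H" "k \<noteq> id" "k y = y" using hy by (auto simp: S_def)
    obtain h' where h': "h' \<in> H" "h' \<circ> h = id" "h \<circ> h' = id"
      using comp_group_inverse H(1) hy(1) by blast
    have hh: "h' (h t) = t" "h (h' t) = t" for t using h' by (simp_all add: fun_eq_iff)
    have "h \<circ> k \<circ> h' \<in> H" using comp_group_closed[OF H(1)] h' k hy by blast
    moreover have "h \<circ> k \<circ> h' \<noteq> id"
    proof
      assume eq: "h \<circ> k \<circ> h' = id"
      have "k t = t" for t
        using fun_cong[OF eq, of "h t"] hh by (simp) (metis hh(1))
      then show False using k by auto
    qed
    moreover have "(h \<circ> k \<circ> h') (h y) = h y" using k hh by simp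
    ultimately show ?thesis unfolding S_def by blast
  qed
  have orb_eq: "orb (h y) = orb y" if h: "h \<in> H" for h y
  proof -
    obtain h' where h': "h' \<in> H" "h' \<circ> h = id"
      using comp_group_inverse H(1) h by blast
    have "k (h y) \<in> orb y" if "k \<in> H" for k
      using comp_group_closed(2)[OF H(1) that h] unfolding orb_def
      by (intro image_eqI[of _ _ "k \<circ> h"]) simp_all
    moreover have "k y \<in> orb (h y)" if "k \<in> H" for k
    proof -
      have "k y = (k \<circ> h') (h y)" using h' by (simp add: fun_eq_iff)
      then show ?thesis using comp_group_closed(2)[OF H(1) that h'(1)] unfolding orb_def by (rule image_eqI)
    qed
    ultimately show ?thesis by (auto simp: orb_def)
  qed
  have small: "3 * card (orb y) \<le> N" if y: "y \<in> S" for y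
  proof -
    define m where "m = card {h \<in> H. h y = y}"
    have eq: "card (orb y) * m = N"
      using comp_group_orbit_stabilizer[OF H(1)] by (simp add: orb_def m_def N_def)
    then have "odd m" using H(3) unfolding N_def by (metis even_mult_iff)
    obtain k where "k \<in> H" "k \<noteq> id" "k y = y" using y by (auto simp: S_def)
    then have "card {id, k} \<le> m"
      unfolding m_def using H(2) comp_group_closed(1)[OF H(1)] by (intro card_mono) auto
    then have "m \<ge> 3" using \<open>odd m\<close> \<open>k \<noteq> id\<close> by (cases "m = 2") auto
    then show ?thesis using eq by (metis mult.commute mult_le_mono2)
  qed
  have "S \<subseteq> \<Union> (orb ` S)"
  proof
    fix y assume "y \<in> S"
    moreover have "y \<in> orb y" unfolding orb_def using comp_group_closed(1)[OF H(1)]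
      by (intro image_eqI[of _ _ id]) simp_all
    ultimately show "y \<in> \<Union> (orb ` S)" by blast
  qed
  then have "card S \<le> card (\<Union> (orb ` S))"
    using finS H(2) by (intro card_mono) (auto simp: orb_def)
  also have "\<dots> \<le> (\<Sum>B\<in>orb ` S. card B)" by (intro card_Union_le_sum_card)
  finally have "3 * card S \<le> (\<Sum>B\<in>orb ` S. 3 * card B)" by (simp add: sum_distrib_left[symmetric])
  also have "\<dots> \<le> (\<Sum>B\<in>orb ` S. N)" using small by (intro sum_mono) auto
  finally have le: "3 * card S \<le> r * N" by (simp add: r_def)
  have "r * N = card S + (\<Sum>h\<in>H - {id}. card {y \<in> S. h y = y})"
    using comp_group_burnside[OF H(1,2) finS] inv by (simp add: r_def N_def orb_def)
  also have "(\<Sum>h\<in>H - {id}. card {y \<in> S. h y = y}) = (\<Sum>h\<in>H - {id}. 2)"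
  proof (rule sum.cong)
    fix h assume h: "h \<in> H - {id}"
    then have "{y \<in> S. h y = y} = {y. h y = y}" by (auto simp: S_def)
    then show "card {y \<in> S. h y = y} = 2" using two h by simp
  qed simp
  also have "\<dots> = 2 * (N - 1)"
    using H(2) comp_group_closed(1)[OF H(1)] by (simp add: N_def card_Diff_singleton)
  finally have count: "r * N = card S + 2 * (N - 1)" .
  have "x \<in> S" using x by (auto simp: S_def)
  then have "card S > 0" using finS by (auto simp: card_gt_0_iff)
  have "N > 0" using H(3) unfolding N_def by (rule odd_pos)
  \<comment> \<open>From \<open>r \<ge> 3\<close> it would follow that \<open>2 r N \<le> 6 (N - 1) < 6 N\<close>.\<close>
  have "r < 3"
  proof (rule ccontr)
    assume "\<not> r < 3"
    then have "3 * N \<le> r * N" by simp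
    then show False using le count \<open>N > 0\<close> by linarith
  qed
  then have "r = 0 \<or> r = 1 \<or> r = 2" by auto
  moreover have "card (orb y) > 0" for y
    using H(2) comp_group_closed(1)[OF H(1)] by (auto simp: orb_def card_gt_0_iff)
  then have "N \<ge> 3" using small[OF \<open>x \<in> S\<close>] by (metis One_nat_def Suc_leI dual_order.trans mult.right_neutral mult_le_mono2)
  \<comment> \<open>For \<open>r = 1\<close> the count would read \<open>card S = 2 - N < 0\<close>; for \<open>r = 2\<close> it reads
  \<open>card S = 2\<close>.\<close>
  ultimately have "r = card S" using count \<open>card S > 0\<close> by auto
  then have "inj_on orb S" using finS by (simp add: r_def eq_card_imp_inj_on)
  then show ?thesis using orb_eq[OF g, of x] inv[OF g] \<open>x \<in> S\<close> by (auto dest: inj_onD)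
qed

section \<open>Deck groups of maps with generic fibres\<close>

lemma Deck_eq_comp_group: "Deck F = comp_group (carrier (Deck F))"
  by (simp add: Deck_def)

lemma mem_Deck: "\<mu> \<in> carrier (Deck F) \<longleftrightarrow> moebius_map \<mu> \<and> F \<circ> \<mu> = F"
  by (simp add: Deck_def)

lemma group_Deck: "group (Deck F)"
proof (rule groupI)
  fix \<mu> assume "\<mu> \<in> carrier (Deck F)"
  then have \<mu>: "moebius_map \<mu>" "F \<circ> \<mu> = F" by (auto simp: mem_Deck)
  obtain \<nu> where \<nu>: "moebius_map \<nu>" "\<mu> \<circ> \<nu> = id" "\<nu> \<circ> \<mu> = id"
    using moebius_inverse \<mu> by blast
  have "F \<circ> \<nu> = F \<circ> \<mu> \<circ> \<nu>" using \<mu> by simp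
  also have "\<dots> = F" using \<nu> by (simp add: o_assoc[symmetric])
  finally show "\<exists>\<nu>\<in>carrier (Deck F). \<nu> \<otimes>\<^bsub>Deck F\<^esub> \<mu> = \<one>\<^bsub>Deck F\<^esub>"
    using \<nu> by (auto simp: Deck_def)
qed (auto simp: Deck_def moebius_comp moebius_id o_assoc simp del: id_apply)

text \<open>
  For a rational map \<open>n\<close> is the degree. In this form it passes to iterates without any discussion of
  their critical points.
\<close>

definition generic_fibre_card :: "('a \<Rightarrow> 'b) \<Rightarrow> nat \<Rightarrow> bool" where
  "generic_fibre_card F n \<longleftrightarrow> (\<exists>B. finite B \<and> (\<forall>w. w \<notin> B \<longrightarrow> card (F -` {w}) = n))"

text \<open>
  The exceptional values of \<open>F \<circ> G\<close> are among those of \<open>F\<close> and the images under \<open>F\<close> of those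
  of \<open>G\<close>. Every other fibre is a disjoint union of \<open>m\<close> fibres of \<open>G\<close>.
\<close>

lemma generic_fibre_card_comp:
  assumes "generic_fibre_card F m" "generic_fibre_card G n" "m > 0" "n > 0"
  shows "generic_fibre_card (F \<circ> G) (m * n)"
proof -
  obtain A B where A: "finite A" "\<And>w. w \<notin> A \<Longrightarrow> card (F -` {w}) = m"
    and B: "finite B" "\<And>w. w \<notin> B \<Longrightarrow> card (G -` {w}) = n"
    using assms unfolding generic_fibre_card_def by blast
  have "card ((F \<circ> G) -` {w}) = m * n" if w: "w \<notin> A \<union> F ` B" for w
  proof -
    have "(F \<circ> G) -` {w} = (\<Union>y\<in>F -` {w}. G -` {y})" by auto
    moreover have "card (F -` {w}) = m" using A w by auto
    moreover from this have "finite (F -` {w})" using assms by (metis card.infinite less_numeral_extra(3))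
    moreover have "card (G -` {y}) = n" if "y \<in> F -` {w}" for y using B w that by auto
    moreover from this have "finite (G -` {y})" if "y \<in> F -` {w}" for y
      using assms that by (metis card.infinite less_numeral_extra(3))
    moreover have "card (\<Union>y\<in>F -` {w}. G -` {y}) = (\<Sum>y\<in>F -` {w}. card (G -` {y}))"
      using calculation by (intro card_UN_disjoint) auto
    ultimately show ?thesis by simp
  qed
  moreover have "finite (A \<union> F ` B)" using A B by simp
  ultimately show ?thesis unfolding generic_fibre_card_def by meson
qed

lemma generic_fibre_card_bij:
  assumes "bij F"
  shows "generic_fibre_card F 1"
proof -
  have "card (F -` {w}) = 1" for w
  proof -
    have "F -` {w} = {inv_into UNIV F w}"
      using assms by (auto simp: bij_is_inj bij_is_surj surj_f_inv_f)
    then show ?thesis by simp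
  qed
  then show ?thesis unfolding generic_fibre_card_def by blast
qed

lemma generic_fibre_card_funpow:
  fixes F :: "'a \<Rightarrow> 'a"
  assumes "generic_fibre_card F d" "d > 0"
  shows "generic_fibre_card (F ^^ k) (d ^ k)"
proof (induction k)
  case 0
  show ?case using generic_fibre_card_bij[OF bij_id] by (simp only: funpow.simps power_0)
next
  case (Suc k)
  then show ?case
    using generic_fibre_card_comp[OF assms(1) Suc] assms(2) by (simp only: funpow.simps power_Suc zero_less_power)
qed

lemma infinite_riemann_sphere: "infinite (UNIV :: riemann_sphere set)"
proof
  assume "finite (UNIV :: riemann_sphere set)"
  then have "finite (Fin -` UNIV)" by (intro finite_vimageI) (auto simp: inj_def)
  then show False using infinite_UNIV_char_0[where 'a = complex] by simp
qed

text \<open>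
  Deck transformations permute each fibre. Choose points \<open>x1\<close>, \<open>x2\<close>, \<open>x3\<close> in three distinct finite
  fibres: a deck transformation is determined by its values at them, and there are only finitely many
  possible values.
\<close>

lemma finite_Deck:
  assumes F: "generic_fibre_card F n" "n > 0"
  shows "finite (carrier (Deck F))"
proof -
  obtain B where B: "finite B" "\<And>w. w \<notin> B \<Longrightarrow> card (F -` {w}) = n"
    using F unfolding generic_fibre_card_def by blast
  have "infinite (- B)" using B infinite_riemann_sphere by (simp add: Compl_eq_Diff_UNIV)
  then obtain W where W: "W \<subseteq> - B" "card W = 3"
    using infinite_arbitrarily_large by blast
  then obtain w1 w2 w3 where w: "W = {w1, w2, w3}" "distinct [w1, w2, w3]"
    by (auto simp: card_3_iff)
  have fin: "finite (F -` {w})" "F -` {w} \<noteq> {}" if "w \<in> W" for w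
  proof -
    have "card (F -` {w}) > 0" using B(2)[of w] W(1) that F(2) by auto
    then show "finite (F -` {w})" "F -` {w} \<noteq> {}" by (simp_all add: card_gt_0_iff)
  qed
  have "\<exists>x. F x = w" if "w \<in> W" for w using fin(2)[OF that] by blast
  then obtain x1 x2 x3 where x: "F x1 = w1" "F x2 = w2" "F x3 = w3" using w(1) by (metis insertCI)
  define T where "T = (\<Union>w\<in>W. F -` {w})"
  have "finite T" using fin w by (auto simp: T_def)
  have "inj_on (\<lambda>\<mu>. (\<mu> x1, \<mu> x2, \<mu> x3)) (carrier (Deck F))"
  proof (rule inj_onI)
    fix \<mu> \<nu> assume "\<mu> \<in> carrier (Deck F)" "\<nu> \<in> carrier (Deck F)"
      and eq: "(\<mu> x1, \<mu> x2, \<mu> x3) = (\<nu> x1, \<nu> x2, \<nu> x3)"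
    then have m: "moebius_map \<mu>" "moebius_map \<nu>" by (auto simp: mem_Deck)
    obtain \<nu>' where \<nu>': "moebius_map \<nu>'" "\<nu> \<circ> \<nu>' = id" "\<nu>' \<circ> \<nu> = id"
      using moebius_inverse m by blast
    have hh: "\<nu>' (\<nu> t) = t" for t using \<nu>' by (simp add: fun_eq_iff)
    have "\<nu>' \<circ> \<mu> = id"
      using x w eq hh by (intro moebius_three_fixed_points[of _ x1 x2 x3] moebius_comp \<nu>' m) auto
    then have "\<nu> \<circ> \<nu>' \<circ> \<mu> = \<nu>" by (simp add: o_assoc[symmetric])
    then show "\<mu> = \<nu>" using \<nu>' by simp
  qed
  moreover have "(\<lambda>\<mu>. (\<mu> x1, \<mu> x2, \<mu> x3)) ` carrier (Deck F) \<subseteq> T \<times> T \<times> T"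
    using x w by (auto simp: T_def mem_Deck fun_eq_iff)
  ultimately show ?thesis
    using \<open>finite T\<close> by (meson finite_SigmaI finite_imageD finite_subset)
qed

text \<open>
  A fibre that avoids the finitely many fixed points of nontrivial deck transformations is acted on
  freely, so its size is the number of orbits times the order of the group.
\<close>

lemma card_Deck_dvd:
  assumes F: "generic_fibre_card F n" "n > 0"
  shows "card (carrier (Deck F)) dvd n"
proof -
  define H where "H = carrier (Deck F)"
  have H: "group (comp_group H)" "finite H"
    using group_Deck[of F] finite_Deck[OF F] Deck_eq_comp_group[of F] by (simp_all add: H_def)
  obtain B where B: "finite B" "\<And>w. w \<notin> B \<Longrightarrow> card (F -` {w}) = n"
    using F unfolding generic_fibre_card_def by blast
  define P where "P = (\<Union>g\<in>H - {id}. {x. g x = x})"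
  have "card {x. g x = x} = 2" if g: "g \<in> H - {id}" for g
  proof -
    obtain m where "m > 0" "g ^^ m = id" using comp_group_finite_order[OF H] g by blast
    then show ?thesis
      using g by (intro finite_order_moebius_fixed_points[of g m]) (auto simp: H_def mem_Deck)
  qed
  then have "finite {x. g x = x}" if "g \<in> H - {id}" for g
    using that by (metis card.infinite zero_neq_numeral)
  then have "finite P" using H by (auto simp: P_def)
  then have "finite (B \<union> F ` P)" using B by simp
  then obtain w where w: "w \<notin> B \<union> F ` P"
    using infinite_riemann_sphere ex_new_if_finite by blast
  define E where "E = F -` {w}"
  have "card E = n" using B(2)[of w] w by (simp add: E_def)
  then have "finite E" using F(2) by (metis card.infinite less_numeral_extra(3))
  have none: "{x \<in> E. g x = x} = {}" if "g \<in> H - {id}" for g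
    using that w by (auto simp: E_def P_def)
  have "card ((\<lambda>x. (\<lambda>g. g x) ` H) ` E) * card H = card E + (\<Sum>g\<in>H - {id}. card {x \<in> E. g x = x})"
    using H \<open>finite E\<close> 
    by (intro comp_group_burnside) (auto simp: E_def H_def mem_Deck fun_eq_iff)
  also have "\<dots> = n" using none \<open>card E = n\<close> by (simp del: Collect_empty_eq)
  finally show ?thesis by (metis H_def dvd_triv_right)
qed

corollary odd_Deck_fixes_special_point:
  assumes F: "generic_fibre_card F n" "odd n"
    and x: "\<mu>0 \<in> carrier (Deck F)" "\<mu>0 \<noteq> id" "\<mu>0 x = x" and \<mu>: "\<mu> \<in> carrier (Deck F)"
  shows "\<mu> x = x"
proof (rule odd_moebius_group_fixes_special_point[OF _ _ _ _ x \<mu>])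
  have "n > 0" using F(2) by (cases n) auto
  show "group (comp_group (carrier (Deck F)))"
    using group_Deck[of F] Deck_eq_comp_group[of F] by simp
  show "finite (carrier (Deck F))" using finite_Deck F \<open>n > 0\<close> by blast
  show "odd (card (carrier (Deck F)))"
    using card_Deck_dvd[OF F(1) \<open>n > 0\<close>] F(2) by (meson dvd_trans)
qed (simp add: mem_Deck)

section \<open>The Wronskian and the normal form of a bicritical map\<close>

definition power_fun :: "nat \<Rightarrow> riemann_sphere \<Rightarrow> riemann_sphere" where
  "power_fun n x = (case x of Fin z \<Rightarrow> Fin (z ^ n) | Infty \<Rightarrow> Infty)"

lemma power_fun_proj: "n > 0 \<Longrightarrow> power_fun n (proj u v) = proj (u ^ n) (v ^ n)"
  by (simp add: power_fun_def proj_def power_divide)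

text \<open>
  The numerator of the derivative of \<open>p / q\<close>. Its zeros are the finite critical points, counted with
  multiplicity.
\<close>

definition wronskian :: "complex poly \<Rightarrow> complex poly \<Rightarrow> complex poly" where
  "wronskian p q = pderiv p * q - p * pderiv q"

text \<open>
  Postcomposing \<open>p / q\<close> with a Moebius map changes the Wronskian only by the determinant of the
  matrix. This allows a value of \<open>p / q\<close> to be moved to zero or infinity without losing track of the
  critical points.
\<close>

lemma wronskian_combination:
  "wronskian (smult a p + smult b q) (smult c p + smult d q) = smult (a * d - b * c) (wronskian p q)"
proof -
  have "[:a:] * P = smult a P" for a and P :: "complex poly" by simp
  note sm = this[symmetric]
  have const: "[:a * d - b * c:] = [:a:] * [:d:] - [:b:] * [:c:]" by simp
  show ?thesis
    unfolding wronskian_def pderiv_add pderiv_smult unfolding sm const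
    by (simp only: ring_distribs) algebra
qed

lemma wronskian_quotient_derivative:
  assumes "poly q z \<noteq> 0"
  shows "((\<lambda>w. poly p w / poly q w) has_field_derivative 0) (at z) \<longleftrightarrow> poly (wronskian p q) z = 0"
proof -
  have D: "((\<lambda>w. poly p w / poly q w) has_field_derivative
      (poly (pderiv p) z * poly q z - poly p z * poly (pderiv q) z) / (poly q z * poly q z)) (at z)"
    using assms by (intro DERIV_divide poly_DERIV)
  show ?thesis
  proof
    assume "((\<lambda>w. poly p w / poly q w) has_field_derivative 0) (at z)"
    from DERIV_unique[OF this D] show "poly (wronskian p q) z = 0"
      using assms by (simp add: wronskian_def)
  next
    assume "poly (wronskian p q) z = 0"
    then show "((\<lambda>w. poly p w / poly q w) has_field_derivative 0) (at z)"
      using D by (simp add: wronskian_def)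
  qed
qed

lemma wronskian_swap: "wronskian q p = - wronskian p q"
  by (simp add: wronskian_def algebra_simps)

text \<open>
  In the charts the map is \<open>p / q\<close> at a point that is not a pole and \<open>q / p\<close> at a pole. These
  identities hold on the whole plane: at the remaining points both sides are the value \<open>0\<close> of a
  division by zero and the dummy value of the chart.
\<close>

lemma critical_point_Fin_iff:
  assumes "coprime p q"
  shows "Fin z \<in> critical_points (rational_fun p q) \<longleftrightarrow> poly (wronskian p q) z = 0"
proof (cases "poly q z = 0")
  case False
  then have "chart (rational_fun p q (Fin z)) \<circ> rational_fun p q \<circ> chart_inv (Fin z)
      = (\<lambda>w. poly p w / poly q w)"
    by (auto simp: rational_fun_def chart_def chart_inv_def fun_eq_iff)
  then show ?thesis
    using wronskian_quotient_derivative[OF False] by (simp add: critical_points_def chart_def)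
next
  case True
  then have p: "poly p z \<noteq> 0" using coprime_poly_0[OF assms] by blast
  have "chart (rational_fun p q (Fin z)) \<circ> rational_fun p q \<circ> chart_inv (Fin z)
      = (\<lambda>w. poly q w / poly p w)"
    using True by (auto simp: rational_fun_def chart_def chart_inv_def fun_eq_iff)
  then show ?thesis
    using wronskian_quotient_derivative[OF p, of q] by (simp add: critical_points_def chart_def wronskian_swap[of q p])
qed

text \<open>
  The polynomial \<open>w ^ n * p (1 / w)\<close>, which represents \<open>p\<close> in the chart at infinity.
\<close>

definition reversal :: "nat \<Rightarrow> complex poly \<Rightarrow> complex poly" where
  "reversal n p = (\<Sum>i\<le>n. monom (coeff p i) (n - i))"

lemma coeff_reversal: "j \<le> n \<Longrightarrow> coeff (reversal n p) j = coeff p (n - j)"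
proof -
  assume j: "j \<le> n"
  have "coeff (reversal n p) j = (\<Sum>i\<le>n. if i = n - j then coeff p i else 0)"
    unfolding reversal_def coeff_sum by (intro sum.cong) (use j in auto)
  also have "\<dots> = coeff p (n - j)" by (simp add: sum.delta)
  finally show ?thesis .
qed

lemma poly_reversal:
  assumes "degree p \<le> n" "w \<noteq> 0"
  shows "poly (reversal n p) w = w ^ n * poly p (inverse w)"
proof -
  have "poly p (inverse w) = (\<Sum>i\<le>n. coeff p i * inverse w ^ i)"
    unfolding poly_altdef using assms
    by (intro sum.mono_neutral_left) (auto simp: coeff_eq_0)
  also have "w ^ n * \<dots> = (\<Sum>i\<le>n. coeff p i * w ^ (n - i))"
    unfolding sum_distrib_left
  proof (intro sum.cong refl)
    fix i assume "i \<in> {..n}"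
    then have "w ^ n = w ^ (n - i) * w ^ i" by (simp add: power_add[symmetric])
    then show "w ^ n * (coeff p i * inverse w ^ i) = coeff p i * w ^ (n - i)"
      using assms(2) by (simp add: power_inverse)
  qed
  also have "\<dots> = poly (reversal n p) w" by (simp add: reversal_def poly_sum poly_monom)
  finally show ?thesis by simp
qed

lemma max_degree_coeff_nonzero:
  fixes p q :: "complex poly"
  assumes "max (degree p) (degree q) = n" "n > 0"
  shows "coeff p n \<noteq> 0 \<or> coeff q n \<noteq> 0"
proof -
  have "degree p = n \<or> degree q = n" using assms(1) by (auto simp: max_def split: if_splits)
  then show ?thesis using assms(2) by (metis degree_0 leading_coeff_0_iff less_numeral_extra(3))
qed

text \<open>
  In the chart at infinity the map is the quotient of the reversed polynomials, whose Wronskian at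
  zero is \<open>coeff p (n - 1) * coeff q n - coeff p n * coeff q (n - 1)\<close>.
\<close>

lemma critical_point_Infty:
  assumes "max (degree p) (degree q) = n" "n > 0"
    and "coeff p (n - 1) * coeff q n = coeff p n * coeff q (n - 1)"
  shows "Infty \<in> critical_points (rational_fun p q)"
proof -
  define P where "P = reversal n p"
  define Q where "Q = reversal n q"
  have deg: "degree p \<le> n" "degree q \<le> n" using assms by auto
  have away: "poly p (inverse w) / poly q (inverse w) = poly P w / poly Q w" 
      "poly q (inverse w) = 0 \<longleftrightarrow> poly Q w = 0"
    if "w \<noteq> 0" for w
    using that deg by (simp_all add: P_def Q_def poly_reversal)
  have at0: "poly P 0 = coeff p n" "poly Q 0 = coeff q n"
    by (simp_all add: P_def Q_def poly_0_coeff_0 coeff_reversal)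
  have "poly (pderiv P) 0 = coeff p (n - 1)" "poly (pderiv Q) 0 = coeff q (n - 1)"
    using assms(2) by (simp_all add: P_def Q_def poly_0_coeff_0 coeff_pderiv coeff_reversal)
  then have W: "poly (wronskian P Q) 0 = 0"
    using assms(3) at0 by (simp add: wronskian_def)
  then have W': "poly (wronskian Q P) 0 = 0" by (simp add: wronskian_swap[of Q P])
  have fin: "rational_fun p q (Fin x) = (if poly q x = 0 then Infty else Fin (poly p x / poly q x))" for x
    by (simp add: rational_fun_def)
  have val: "rational_fun p q Infty = (if coeff q n = 0 then Infty else Fin (coeff p n / coeff q n))"
    using assms(1) by (simp add: rational_fun_def Let_def)
  show ?thesis
  proof (cases "coeff q n = 0")
    case False
    have "(chart (rational_fun p q Infty) \<circ> rational_fun p q \<circ> chart_inv Infty) w = poly P w / poly Q w" for w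
    proof (cases "w = 0")
      case True
      then show ?thesis using False at0 by (simp add: chart_inv_def val chart_def)
    next
      case nz: False
      then show ?thesis using False away[OF nz]
        by (simp add: chart_inv_def val chart_def fin)
    qed
    then have "chart (rational_fun p q Infty) \<circ> rational_fun p q \<circ> chart_inv Infty = (\<lambda>w. poly P w / poly Q w)"
      by (rule ext)
    moreover have "((\<lambda>w. poly P w / poly Q w) has_field_derivative 0) (at 0)"
      using wronskian_quotient_derivative W False at0 by simp
    ultimately show ?thesis by (simp add: critical_points_def chart_def)
  next
    case True
    then have p: "coeff p n \<noteq> 0" using max_degree_coeff_nonzero assms by blast
    have "(chart (rational_fun p q Infty) \<circ> rational_fun p q \<circ> chart_inv Infty) w = poly Q w / poly P w" for w
    proof (cases "w = 0")
      case True
      then show ?thesis using \<open>coeff q n = 0\<close> at0 by (simp add: chart_inv_def val chart_def)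
    next
      case nz: False
      have "inverse (poly p (inverse w) / poly q (inverse w)) = poly Q w / poly P w"
        unfolding away(1)[OF nz] by simp
      then show ?thesis using True away(2)[OF nz] nz
        by (simp add: chart_inv_def val chart_def fin)
    qed
    then have "chart (rational_fun p q Infty) \<circ> rational_fun p q \<circ> chart_inv Infty = (\<lambda>w. poly Q w / poly P w)"
      by (rule ext)
    moreover have "((\<lambda>w. poly Q w / poly P w) has_field_derivative 0) (at 0)"
      using wronskian_quotient_derivative W' p at0 by simp
    ultimately show ?thesis by (simp add: critical_points_def chart_def)
  qed
qed

text \<open>
  A nontrivial linear relation would make one of the coprime polynomials divide the other, and then
  both would be constant.
\<close>

lemma combination_nonzero:
  fixes p q :: "complex poly"
  assumes "coprime p q" "max (degree p) (degree q) = n" "n > 0" "a \<noteq> 0 \<or> b \<noteq> 0"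
  shows "smult a p + smult b q \<noteq> 0"
proof
  assume eq: "smult a p + smult b q = 0"
  have "degree p = 0 \<and> degree q = 0"
  proof (cases "a = 0")
    case False
    have "smult a p = smult (- b) q" using eq by (simp add: eq_neg_iff_add_eq_0)
    then have "smult (inverse a) (smult a p) = smult (inverse a) (smult (- b) q)" by simp
    then have p: "p = smult (inverse a * - b) q" using False by simp
    have "q dvd p" unfolding p by (rule dvd_smult) simp
    then have "is_unit q" using assms(1) by (simp add: coprime_absorb_right)
    then have "degree q = 0" by (auto simp: is_unit_poly_iff)
    then show ?thesis unfolding p by simp
  next
    case True
    then have "q = 0" using eq assms(4) by simp
    then show ?thesis using assms(1) by (auto simp: is_unit_poly_iff)
  qed
  then show False using assms by simp
qed

text \<open>
  The coefficient of \<open>r' s - r s'\<close> in the top degree is the product of the leading coefficients times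
  \<open>degree r - degree s\<close>. It does not cancel because the degrees differ.
\<close>

lemma degree_wronskian:
  assumes "degree r < degree s" "r \<noteq> 0"
  shows "degree (wronskian r s) = degree r + degree s - 1"
proof (rule antisym)
  have "degree (pderiv r * s) \<le> degree r + degree s - 1"
  proof (cases "degree r = 0")
    case True
    then have "pderiv r = 0" by (simp add: pderiv_eq_0_iff)
    then show ?thesis by simp
  next
    case False
    then show ?thesis using degree_mult_le[of "pderiv r" s] by (simp add: degree_pderiv)
  qed
  moreover have "degree (r * pderiv s) \<le> degree r + degree s - 1"
    using degree_mult_le[of r "pderiv s"] assms by (simp add: degree_pderiv)
  ultimately show "degree (wronskian r s) \<le> degree r + degree s - 1"
    unfolding wronskian_def by (rule degree_diff_le)
  have lead: "coeff (pderiv t) (degree t - 1) = of_nat (degree t) * lead_coeff t" if "degree t > 0" for t :: "complex poly"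
    using that by (simp add: coeff_pderiv del: of_nat_Suc)
  have 1: "coeff (r * pderiv s) (degree r + degree s - 1) = of_nat (degree s) * (lead_coeff r * lead_coeff s)"
    using coeff_mult_degree_sum[of r "pderiv s"] lead[of s] assms by (simp add: degree_pderiv mult_ac)
  have 2: "coeff (pderiv r * s) (degree r + degree s - 1) = of_nat (degree r) * (lead_coeff r * lead_coeff s)"
  proof (cases "degree r = 0")
    case True
    then have "pderiv r = 0" by (simp add: pderiv_eq_0_iff)
    then show ?thesis using True by simp
  next
    case False
    then show ?thesis
      using coeff_mult_degree_sum[of "pderiv r" s] lead[of r] by (simp add: degree_pderiv mult_ac)
  qed
  have "coeff (wronskian r s) (degree r + degree s - 1)
      = (of_nat (degree r) - of_nat (degree s)) * (lead_coeff r * lead_coeff s)"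
    unfolding wronskian_def coeff_diff 1 2 by (simp add: left_diff_distrib)
  also have "\<dots> \<noteq> 0" using assms by auto
  finally show "degree r + degree s - 1 \<le> degree (wronskian r s)" by (rule le_degree)
qed

text \<open>
  Postcomposition with a Moebius map moves the value at infinity to zero, so that the numerator has
  smaller degree than the denominator.
\<close>

lemma degree_lowering_combination:
  fixes p q :: "complex poly"
  assumes "coprime p q" "max (degree p) (degree q) = n" "n > 0"
  obtains a b c d where "a * d - b * c \<noteq> 0"
    "degree (smult a p + smult b q) < n" "degree (smult c p + smult d q) = n"
proof (cases "coeff q n = 0")
  case True
  then have "coeff p n \<noteq> 0" using max_degree_coeff_nonzero assms by blast
  then have "degree p = n" using assms(2) le_degree by fastforce
  moreover have "degree q < n" using assms True
    by (metis leading_coeff_0_iff max.cobounded2 le_neq_implies_less degree_0)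
  ultimately show ?thesis using that[of 0 0 1 1] by simp
next
  case False
  define r where "r = smult 1 p + smult (- (coeff p n / coeff q n)) q"
  have "degree q = n" using assms(2) False le_degree by fastforce
  moreover have "degree r < n"
  proof -
    have "degree r \<le> n" unfolding r_def using assms(2) by (intro degree_add_le degree_smult_le[THEN order_trans]) auto
    moreover have "coeff r n = 0" using False by (simp add: r_def)
    ultimately show ?thesis using assms(3)
      by (metis degree_0 le_neq_implies_less leading_coeff_0_iff)
  qed
  ultimately show ?thesis using that[of 1 1 "- (coeff p n / coeff q n)" 0] unfolding r_def by simp
qed

text \<open>
  For a map of degree \<open>n\<close> the Wronskian has degree at least \<open>n - 1\<close>, and the excess is the degree of
  a combination of numerator and denominator. If infinity is not critical, the Wronskian has the full
  degree \<open>2 (n - 1)\<close> predicted by the Riemann-Hurwitz formula.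
\<close>

lemma degree_wronskian_rational:
  fixes p q :: "complex poly"
  assumes "coprime p q" "max (degree p) (degree q) = n" "n > 0"
  obtains a b where "a \<noteq> 0 \<or> b \<noteq> 0" "smult a p + smult b q \<noteq> 0" 
    "degree (wronskian p q) = degree (smult a p + smult b q) + n - 1"
    "coeff p (n - 1) * coeff q n \<noteq> coeff p n * coeff q (n - 1) \<longrightarrow> degree (smult a p + smult b q) = n - 1"
proof -
  obtain a b c d where det: "a * d - b * c \<noteq> 0" and
    deg: "degree (smult a p + smult b q) < n" "degree (smult c p + smult d q) = n"
    by (rule degree_lowering_combination[OF assms])
  define r where "r = smult a p + smult b q"
  define s where "s = smult c p + smult d q"
  have ab: "a \<noteq> 0 \<or> b \<noteq> 0" using det by auto
  then have "r \<noteq> 0" unfolding r_def by (rule combination_nonzero[OF assms])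
  have "wronskian r s = smult (a * d - b * c) (wronskian p q)"
    by (simp add: r_def s_def wronskian_combination)
  then have "degree (wronskian p q) = degree (wronskian r s)" using det by simp
  also have "\<dots> = degree r + n - 1"
    using degree_wronskian[of r s] deg \<open>r \<noteq> 0\<close> by (simp add: r_def s_def)
  finally have W: "degree (wronskian p q) = degree r + n - 1" .
  have "degree r = n - 1" if ne: "coeff p (n - 1) * coeff q n \<noteq> coeff p n * coeff q (n - 1)"
  proof -
    have r0: "coeff r n = 0" by (rule coeff_eq_0) (use deg in \<open>simp add: r_def\<close>)
    have "coeff r (n - 1) * coeff s n - coeff r n * coeff s (n - 1)
      = (a * d - b * c) * (coeff p (n - 1) * coeff q n - coeff p n * coeff q (n - 1))"
      unfolding r_def s_def coeff_add coeff_smult by (simp add: ring_distribs mult_ac)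
    also have "\<dots> \<noteq> 0" using det ne by simp
    finally have "coeff r (n - 1) \<noteq> 0" using r0 by auto
    then have "n - 1 \<le> degree r" by (rule le_degree)
    then show ?thesis using deg(1) by (simp add: r_def)
  qed
  then show ?thesis using that[OF ab] \<open>r \<noteq> 0\<close> W unfolding r_def by metis
qed

text \<open>
  Away from the zeros of \<open>s\<close> the Wronskian of \<open>r\<close> and \<open>s\<close> vanishes to one order less than \<open>r\<close>
  at a zero of \<open>r\<close>, just like the derivative of \<open>r\<close>.
\<close>

lemma wronskian_order_dvd:
  assumes "[:- z, 1:] ^ m dvd wronskian r s" "poly s z \<noteq> 0" "poly r z = 0" "r \<noteq> 0"
  shows "[:- z, 1:] ^ Suc m dvd r"
proof (rule ccontr)
  define e where "e = Polynomial.order z r"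
  assume "\<not> ?thesis"
  then have "\<not> Suc m \<le> e" using assms(4) unfolding e_def order_divides by blast
  then have "e \<le> m" by simp
  then have 1: "[:- z, 1:] ^ e dvd wronskian r s" using assms(1) power_le_dvd by blast
  have 2: "[:- z, 1:] ^ e dvd r * pderiv s" unfolding e_def by (intro dvd_mult2 order_1)
  have "[:- z, 1:] ^ e dvd wronskian r s + r * pderiv s" using 1 2 by (rule dvd_add)
  then have 3: "[:- z, 1:] ^ e dvd pderiv r * s" by (simp add: wronskian_def)
  have suc: "e = Suc (Polynomial.order z (pderiv r))" unfolding e_def by (rule order_pderiv[OF assms(4,3)])
  have "pderiv r \<noteq> 0"
  proof
    assume "pderiv r = 0"
    then obtain c where "r = [:c:]" by (metis degree_eq_zeroE pderiv_eq_0_iff)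
    then show False using assms by auto
  qed
  then have nz: "pderiv r * s \<noteq> 0" using assms(2) by auto
  have "e \<le> Polynomial.order z (pderiv r * s)" using 3 nz by (simp add: order_divides)
  also have "\<dots> = Polynomial.order z (pderiv r)" using nz assms(2) by (simp add: order_mult order_0I)
  finally show False using suc by simp
qed

text \<open>
  At a zero of order \<open>m\<close> of the Wronskian the map takes its value with multiplicity \<open>m + 1\<close>, and a
  multiplicity is at most the degree. The combination is the one that vanishes at \<open>z\<close>, that is, the
  numerator after the value at \<open>z\<close> has been moved to zero. For \<open>m = n - 1\<close> the factor \<open>r\<close> is
  constant and the combination is a multiple of \<open>(x - z) ^ n\<close>.
\<close>

lemma fully_ramified_combination:
  fixes p q :: "complex poly"
  assumes "coprime p q" "max (degree p) (degree q) = n" "n > 0" "[:- z, 1:] ^ m dvd wronskian p q"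
  obtains a b r where "a \<noteq> 0 \<or> b \<noteq> 0" "smult a p + smult b q = [:- z, 1:] ^ Suc m * r" "r \<noteq> 0"
    "Suc m + degree r \<le> n"
proof -
  define a where "a = poly q z"
  define b where "b = - poly p z"
  \<comment> \<open>A complementary row: the value at \<open>z\<close> of the second combination is
  \<open>|p z|\<^sup>2 + |q z|\<^sup>2\<close>, which is nonzero.\<close>
  define c where "c = cnj (poly p z)"
  define d where "d = cnj (poly q z)"
  define R where "R = smult a p + smult b q"
  define s where "s = smult c p + smult d q"
  have ab: "a \<noteq> 0 \<or> b \<noteq> 0" using coprime_poly_0[OF assms(1), of z] by (auto simp: a_def b_def)
  then have R: "R \<noteq> 0" unfolding R_def by (rule combination_nonzero[OF assms(1-3)])
  have "poly R z = 0" by (simp add: R_def a_def b_def)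
  moreover have "poly s z \<noteq> 0"
  proof -
    have "poly s z = of_real ((norm (poly p z))\<^sup>2 + (norm (poly q z))\<^sup>2)"
      by (simp only: s_def c_def d_def poly_add poly_smult of_real_add complex_norm_square mult.commute)
    moreover have "(norm (poly p z))\<^sup>2 + (norm (poly q z))\<^sup>2 \<noteq> 0"
      using coprime_poly_0[OF assms(1), of z] by (simp add: sum_power2_eq_zero_iff)
    ultimately show ?thesis by (metis of_real_eq_0_iff)
  qed
  moreover have "[:- z, 1:] ^ m dvd wronskian R s"
    unfolding R_def s_def wronskian_combination by (intro dvd_smult assms(4))
  ultimately have "[:- z, 1:] ^ Suc m dvd R" using wronskian_order_dvd R by blast
  then obtain r where r: "R = [:- z, 1:] ^ Suc m * r" by (rule dvdE)
  then have rnz: "r \<noteq> 0" using R by auto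
  have "degree R = Suc m + degree r"
    unfolding r using rnz by (subst degree_mult_eq) (simp_all add: degree_linear_power del: power_Suc)
  moreover have "degree R \<le> n" unfolding R_def using assms(2)
    by (intro degree_add_le degree_smult_le[THEN order_trans]) auto
  ultimately show ?thesis using that[OF ab r[unfolded R_def] rnz] by simp
qed

lemma top_coeff_linear_power:
  fixes a b :: complex
  shows "coeff ([:a, b:] ^ n) n = b ^ n"
proof (induction n)
  case (Suc n)
  have "degree ([:a, b:] ^ n) \<le> n"
    using degree_power_le[of "[:a, b:]" n] by (simp split: if_splits)
  then have "coeff ([:a, b:] ^ n) (Suc n) = 0" by (simp add: coeff_eq_0)
  then show ?case using Suc by simp
qed simp

text \<open>
  The two combinations are the coordinates of \<open>R \<circ> f\<close>, where \<open>f = p / q\<close> and \<open>R\<close> is the Moebius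
  map with rows \<open>(a1, b1)\<close> and \<open>(a2, b2)\<close>. So \<open>R \<circ> f\<close> is a multiple of the
  \<open>n\<close>-th power of \<open>(z - x) / (c z + d)\<close>. The parameters \<open>c\<close> and \<open>d\<close> cover at once a second
  critical point that is finite (\<open>c = 1\<close>) or infinity (\<open>c = 0\<close>, \<open>d = 1\<close>).
\<close>

lemma rational_fun_eq_moebius_power:
  fixes p q :: "complex poly"
  assumes pq: "coprime p q" "max (degree p) (degree q) = n" "n > 0"
    and r1: "smult a1 p + smult b1 q = smult c1 ([:- x, 1:] ^ n)" "c1 \<noteq> 0" "a1 \<noteq> 0 \<or> b1 \<noteq> 0"
    and r2: "smult a2 p + smult b2 q = smult c2 ([:d, c:] ^ n)" "c2 \<noteq> 0"
    and det: "c * x + d \<noteq> 0"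
  obtains M where "moebius_map M" "rational_fun p q = M \<circ> power_fun n \<circ> moeb 1 (- x) c d"
proof -
  define R where "R = moeb a1 b1 a2 b2"
  define K where "K = moeb c1 0 0 c2"
  define N where "N = moeb 1 (- x) c d"
  have e1: "a1 * poly p z + b1 * poly q z = c1 * (z - x) ^ n" for z
    using arg_cong[OF r1(1), of "\<lambda>r. poly r z"] by simp
  have e2: "a2 * poly p z + b2 * poly q z = c2 * (c * z + d) ^ n" for z
    using arg_cong[OF r2(1), of "\<lambda>r. poly r z"] by (simp add: add.commute mult.commute)
  have t1: "a1 * coeff p n + b1 * coeff q n = c1"
    using arg_cong[OF r1(1), of "\<lambda>r. coeff r n"] by (simp only: coeff_add coeff_smult top_coeff_linear_power) simp
  have t2: "a2 * coeff p n + b2 * coeff q n = c2 * c ^ n"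
    using arg_cong[OF r2(1), of "\<lambda>r. coeff r n"] by (simp only: coeff_add coeff_smult top_coeff_linear_power)
  \<comment> \<open>Otherwise the two combinations would be proportional, but only the first vanishes at \<open>x\<close>.\<close>
  have detR: "a1 * b2 - b1 * a2 \<noteq> 0"
  proof
    assume 0: "a1 * b2 - b1 * a2 = 0"
    define P where "P = poly p x"
    define Q where "Q = poly q x"
    define C where "C = c2 * (c * x + d) ^ n"
    have 1: "a1 * P + b1 * Q = 0" using e1[of x] pq(3) by (simp add: P_def Q_def)
    have 2: "a2 * P + b2 * Q = C" using e2[of x] by (simp add: P_def Q_def C_def)
    have "a1 * C = (a1 * b2 - b1 * a2) * Q + a2 * (a1 * P + b1 * Q)"
      unfolding 2[symmetric] by (simp add: algebra_simps)
    then have "a1 * C = 0" using 0 1 by simp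
    have "b1 * C = b2 * (a1 * P + b1 * Q) - (a1 * b2 - b1 * a2) * P"
      unfolding 2[symmetric] by (simp add: algebra_simps)
    then have "b1 * C = 0" using 0 1 by simp
    with \<open>a1 * C = 0\<close> r1(3) have "C = 0" by auto
    then show False using r2(2) det by (simp add: C_def)
  qed
  have detN: "1 * d - (- x) * c \<noteq> 0" using det by (simp add: add.commute mult.commute)
  have detK: "c1 * c2 - 0 * 0 \<noteq> 0" using r1 r2 by simp
  have rhs: "(K \<circ> power_fun n \<circ> N) (proj u v) = proj (c1 * (u - x * v) ^ n) (c2 * (c * u + d * v) ^ n)"
    if uv: "u \<noteq> 0 \<or> v \<noteq> 0" for u v
  proof -
    have ne: "u - x * v \<noteq> 0 \<or> c * u + d * v \<noteq> 0"
      using nonsingular_apply[OF detN uv] by simp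
    have "N (proj u v) = proj (u - x * v) (c * u + d * v)"
      unfolding N_def moeb_proj[OF detN uv] by simp
    then have "(K \<circ> power_fun n \<circ> N) (proj u v) = K (proj ((u - x * v) ^ n) ((c * u + d * v) ^ n))"
      using power_fun_proj[OF pq(3)] by simp
    also have "\<dots> = proj (c1 * (u - x * v) ^ n) (c2 * (c * u + d * v) ^ n)"
      unfolding K_def using ne by (subst moeb_proj[OF detK]) auto
    finally show ?thesis .
  qed
  have "(R \<circ> rational_fun p q) y = (K \<circ> power_fun n \<circ> N) y" for y
  proof (cases y)
    case (Fin z)
    have "rational_fun p q y = proj (poly p z) (poly q z)"
      by (simp add: Fin rational_fun_def proj_def)
    then have "(R \<circ> rational_fun p q) y = proj (c1 * (z - x) ^ n) (c2 * (c * z + d) ^ n)"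
      unfolding R_def using moeb_proj[OF detR coprime_poly_0[OF pq(1), of z]] by (simp add: e1 e2)
    moreover have "y = proj z 1" by (simp add: Fin proj_def)
    ultimately show ?thesis using rhs[of z 1] by simp
  next
    case Infty
    have "rational_fun p q y = proj (coeff p n) (coeff q n)"
      using pq(2) by (simp add: Infty rational_fun_def proj_def Let_def)
    then have "(R \<circ> rational_fun p q) y = proj c1 (c2 * c ^ n)"
      unfolding R_def using moeb_proj[OF detR max_degree_coeff_nonzero[OF pq(2,3)]] by (simp add: t1 t2)
    moreover have "y = proj 1 0" by (simp add: Infty proj_def)
    ultimately show ?thesis using rhs[of 1 0] by simp
  qed
  then have eq: "R \<circ> rational_fun p q = K \<circ> power_fun n \<circ> N" by (rule ext)
  obtain R' where R': "moebius_map R'" "R' \<circ> R = id"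
    using moebius_inverse[OF moebius_moeb[OF detR]] unfolding R_def by metis
  have "rational_fun p q = R' \<circ> (R \<circ> rational_fun p q)" unfolding o_assoc R'(2) by simp
  also have "\<dots> = (R' \<circ> K) \<circ> power_fun n \<circ> N" unfolding eq by (simp only: o_assoc)
  finally have "rational_fun p q = (R' \<circ> K) \<circ> power_fun n \<circ> N" .
  moreover have "moebius_map (R' \<circ> K)"
    unfolding K_def by (intro moebius_comp R' moebius_moeb detK)
  ultimately show ?thesis using that unfolding N_def by blast
qed

lemma rootless_degree_0:
  fixes p :: "complex poly"
  assumes "\<And>z. poly p z \<noteq> 0"
  shows "degree p = 0"
  using fundamental_theorem_of_algebra[of p] assms constant_degree by blast

text \<open>
  At least one critical point is finite. A finite critical point is a zero of the Wronskian of order at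
  most \<open>n - 1\<close>. If both are finite, these orders add up to \<open>2 (n - 1)\<close>; if the other one is
  infinity, the single zero has order at least \<open>n - 1\<close>. Either way equality holds, so the two critical
  values are taken with full multiplicity.
\<close>

lemma bicritical_normal_form:
  assumes "bicritical f" "rational_degree f = n"
  obtains M N x1 x2 where "moebius_map M" "moebius_map N" "f = M \<circ> power_fun n \<circ> N"
    "critical_points f = {x1, x2}" "N x1 = Fin 0" "N x2 = Infty" "n \<ge> 2"
proof -
  obtain p q where pq: "coprime p q" and f: "f = rational_fun p q"
    using assms(1) unfolding bicritical_def rational_map_def by blast
  have n: "max (degree p) (degree q) = n"
    using assms(2) rational_degree_eq[OF pq] f by simp
  define W where "W = wronskian p q"
  have crit: "Fin z \<in> critical_points f \<longleftrightarrow> poly W z = 0" for z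
    unfolding f W_def by (rule critical_point_Fin_iff[OF pq])
  have card2: "card (critical_points f) = 2" using assms(1) by (simp add: bicritical_def)
  then have fin: "finite (critical_points f)" by (metis card.infinite zero_neq_numeral)
  have "W \<noteq> 0"
  proof
    assume "W = 0"
    then have "range Fin \<subseteq> critical_points f" using crit by auto
    then have "finite (range Fin)" using fin by (rule finite_subset)
    then have "finite (UNIV :: complex set)" by (rule finite_imageD) (auto simp: inj_def)
    then show False using infinite_UNIV_char_0 by blast
  qed
  have npos: "n > 0"
  proof (rule ccontr)
    assume "\<not> n > 0"
    then have "degree p = 0" "degree q = 0" using n by auto
    then have "pderiv p = 0" "pderiv q = 0" by (simp_all add: pderiv_eq_0_iff)
    then show False using \<open>W \<noteq> 0\<close> by (simp add: W_def wronskian_def)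
  qed
  obtain y1 y2 where y: "critical_points f = {y1, y2}" "y1 \<noteq> y2"
    using card2 unfolding card_2_iff by blast
  then obtain x1 y where x1: "critical_points f = {Fin x1, y}" "Fin x1 \<noteq> y"
    by (metis insert_commute riemann_sphere.exhaust)
  define m1 where "m1 = Polynomial.order x1 W"
  obtain U1 where U1: "W = [:- x1, 1:] ^ m1 * U1" "\<not> [:- x1, 1:] dvd U1"
    using order_decomp[OF \<open>W \<noteq> 0\<close>] unfolding m1_def by blast
  have root1: "poly U1 x1 \<noteq> 0" using U1(2) by (simp add: poly_eq_0_iff_dvd)
  have "U1 \<noteq> 0" using root1 by auto
  have "poly W x1 = 0" using crit x1 by blast
  then have "m1 > 0" using \<open>W \<noteq> 0\<close> by (auto simp: m1_def order_root)
  have "[:- x1, 1:] ^ m1 dvd wronskian p q" using U1(1) unfolding W_def by simp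
  then obtain a1 b1 s1 where r1: "a1 \<noteq> 0 \<or> b1 \<noteq> 0"
    "smult a1 p + smult b1 q = [:- x1, 1:] ^ Suc m1 * s1" "s1 \<noteq> 0" "Suc m1 + degree s1 \<le> n"
    by (rule fully_ramified_combination[OF pq n npos])
  have "n \<ge> 2" using r1(4) \<open>m1 > 0\<close> by simp
  have comb1: "\<exists>c1. smult a1 p + smult b1 q = smult c1 ([:- x1, 1:] ^ n) \<and> c1 \<noteq> 0" if m1: "m1 = n - 1"
  proof -
    have "Suc m1 = n" using m1 npos by simp
    moreover from this have "degree s1 = 0" using r1(4) by simp
    then obtain c1 where "s1 = [:c1:]" by (rule degree_eq_zeroE)
    ultimately show ?thesis using r1(2,3) by (intro exI[of _ c1]) simp
  qed
  obtain a b where low: "a \<noteq> 0 \<or> b \<noteq> 0" "smult a p + smult b q \<noteq> 0"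
    "degree W = degree (smult a p + smult b q) + n - 1"
    "coeff p (n - 1) * coeff q n \<noteq> coeff p n * coeff q (n - 1) \<longrightarrow> degree (smult a p + smult b q) = n - 1"
    unfolding W_def by (rule degree_wronskian_rational[OF pq n npos])
  show ?thesis
  proof (cases y)
    case Infty
    have "poly U1 z \<noteq> 0" for z
    proof
      assume z: "poly U1 z = 0"
      then have "poly W z = 0" by (simp add: U1)
      then have "Fin z \<in> {Fin x1, y}" using crit x1 by blast
      then show False using z root1 Infty by auto
    qed
    then have "degree U1 = 0" by (rule rootless_degree_0)
    then have "degree W = m1"
      unfolding U1(1) using \<open>U1 \<noteq> 0\<close> by (subst degree_mult_eq) (simp_all add: degree_linear_power)
    \<comment> \<open>The degree of the Wronskian is at least \<open>n - 1\<close>, while \<open>m1 < n\<close>.\<close>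
    then have "m1 = n - 1" and deg: "degree (smult a p + smult b q) = 0" using low(3) r1(4) by auto
    obtain c1 where c1: "smult a1 p + smult b1 q = smult c1 ([:- x1, 1:] ^ n)" "c1 \<noteq> 0"
      using comb1 \<open>m1 = n - 1\<close> by blast
    obtain c2 where "smult a p + smult b q = [:c2:]" using deg by (rule degree_eq_zeroE)
    then have c2: "smult a p + smult b q = smult c2 ([:1, 0:] ^ n)" "c2 \<noteq> 0"
      using low(2) by (simp_all add: one_pCons[symmetric])
    obtain M where M: "moebius_map M" "rational_fun p q = M \<circ> power_fun n \<circ> moeb 1 (- x1) 0 1"
      using rational_fun_eq_moebius_power[OF pq n npos c1 r1(1) c2] by auto
    show ?thesis
    proof (rule that[OF M(1) _ _ x1(1) _ _ \<open>n \<ge> 2\<close>])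
      show "f = M \<circ> power_fun n \<circ> moeb 1 (- x1) 0 1" using M f by simp
      show "moebius_map (moeb 1 (- x1) 0 1)" by (rule moebius_moeb) simp
      show "moeb 1 (- x1) 0 1 (Fin x1) = Fin 0" "moeb 1 (- x1) 0 1 y = Infty"
        using Infty by (simp_all add: moeb_def proj_def)
    qed
  next
    case (Fin x2)
    have "x1 \<noteq> x2" using x1 Fin by simp
    define m2 where "m2 = Polynomial.order x2 U1"
    obtain U2 where U2: "U1 = [:- x2, 1:] ^ m2 * U2" "\<not> [:- x2, 1:] dvd U2"
      using order_decomp[OF \<open>U1 \<noteq> 0\<close>] unfolding m2_def by blast
    have root2: "poly U2 x2 \<noteq> 0" using U2(2) by (simp add: poly_eq_0_iff_dvd)
    have "poly U2 z \<noteq> 0" for z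
    proof
      assume z: "poly U2 z = 0"
      then have "poly W z = 0" by (simp add: U1 U2)
      then have "Fin z \<in> {Fin x1, y}" using crit x1 by blast
      then show False using z root1 root2 Fin U2(1) by auto
    qed
    then have "degree U2 = 0" by (rule rootless_degree_0)
    moreover have "U2 \<noteq> 0" using root2 by auto
    ultimately have "degree U1 = m2"
      unfolding U2(1) by (subst degree_mult_eq) (simp_all add: degree_linear_power)
    then have degW: "degree W = m1 + m2"
      unfolding U1(1) using \<open>U1 \<noteq> 0\<close> by (subst degree_mult_eq) (simp_all add: degree_linear_power)
    have "W = [:- x2, 1:] ^ m2 * ([:- x1, 1:] ^ m1 * U2)" unfolding U1(1) U2(1) by (simp only: mult_ac)
    then have "[:- x2, 1:] ^ m2 dvd wronskian p q" unfolding W_def by (metis dvd_triv_left)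
    then obtain a2 b2 s2 where r2: "a2 \<noteq> 0 \<or> b2 \<noteq> 0"
      "smult a2 p + smult b2 q = [:- x2, 1:] ^ Suc m2 * s2" "s2 \<noteq> 0" "Suc m2 + degree s2 \<le> n"
      by (rule fully_ramified_combination[OF pq n npos])
    have "Infty \<notin> critical_points f" using x1 Fin by auto
    then have "coeff p (n - 1) * coeff q n \<noteq> coeff p n * coeff q (n - 1)"
      using critical_point_Infty[OF n npos] unfolding f by blast
    then have "m1 + m2 = (n - 1) + n - 1" using low(3,4) degW by simp
    then have m: "m1 = n - 1" "m2 = n - 1" using r1(4) r2(4) by auto
    obtain c1 where c1: "smult a1 p + smult b1 q = smult c1 ([:- x1, 1:] ^ n)" "c1 \<noteq> 0"
      using comb1 m by blast
    have "Suc m2 = n" using m npos by simp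
    moreover from this have "degree s2 = 0" using r2(4) by simp
    then obtain c2 where "s2 = [:c2:]" by (rule degree_eq_zeroE)
    ultimately have c2: "smult a2 p + smult b2 q = smult c2 ([:- x2, 1:] ^ n)" "c2 \<noteq> 0"
      using r2(2,3) by simp_all
    have "1 * x1 + - x2 \<noteq> 0" using \<open>x1 \<noteq> x2\<close> by simp
    then obtain M where M: "moebius_map M" "rational_fun p q = M \<circ> power_fun n \<circ> moeb 1 (- x1) 1 (- x2)"
      by (rule rational_fun_eq_moebius_power[OF pq n npos c1 r1(1) c2])
    show ?thesis
    proof (rule that[OF M(1) _ _ x1(1) _ _ \<open>n \<ge> 2\<close>])
      show "f = M \<circ> power_fun n \<circ> moeb 1 (- x1) 1 (- x2)" using M f by simp
      show "moebius_map (moeb 1 (- x1) 1 (- x2))" using \<open>x1 \<noteq> x2\<close> by (intro moebius_moeb) simp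
      show "moeb 1 (- x1) 1 (- x2) (Fin x1) = Fin 0" "moeb 1 (- x1) 1 (- x2) y = Infty"
        using Fin \<open>x1 \<noteq> x2\<close> by (simp_all add: moeb_def proj_def)
    qed
  qed
qed

section \<open>Rotations and deck groups of iterates\<close>

definition rotation :: "complex \<Rightarrow> riemann_sphere \<Rightarrow> riemann_sphere" where
  "rotation a = moeb a 0 0 1"

lemma rotation_simps [simp]: "rotation a (Fin z) = Fin (a * z)" "a \<noteq> 0 \<Longrightarrow> rotation a Infty = Infty"
  by (simp_all add: rotation_def moeb_def proj_def)

lemma moebius_rotation: "a \<noteq> 0 \<Longrightarrow> moebius_map (rotation a)"
  unfolding rotation_def by (rule moebius_moeb) simp

lemma rotation_comp: "a \<noteq> 0 \<Longrightarrow> b \<noteq> 0 \<Longrightarrow> rotation a \<circ> rotation b = rotation (a * b)"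
  by (rule ext, case_tac x) auto

lemma rotation_inject: "rotation a = rotation b \<Longrightarrow> a = b"
  by (drule fun_cong[of _ _ "Fin 1"]) simp

lemma rotation_1: "rotation 1 = id"
  by (rule ext, case_tac x) auto

lemma moebius_fixing_0_Infty:
  assumes "moebius_map \<mu>" "\<mu> (Fin 0) = Fin 0" "\<mu> Infty = Infty"
  obtains a where "a \<noteq> 0" "\<mu> = rotation a"
proof -
  obtain a b c d where *: "a * d - b * c \<noteq> 0" "\<mu> = moeb a b c d"
    using assms moebius_map_iff by blast
  have c: "c = 0" using assms * moeb_fixed_Infty by blast
  have b: "b = 0" using assms(2) unfolding *(2) moeb_fixed_Fin[OF *(1)] by simp
  have "a \<noteq> 0" "d \<noteq> 0" using * b c by auto
  then have "\<mu> = rotation (a / d)"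
    unfolding *(2) b c by (intro ext, case_tac x) (auto simp: moeb_def proj_def)
  then show ?thesis using that[of "a / d"] \<open>a \<noteq> 0\<close> \<open>d \<noteq> 0\<close> by simp
qed

lemma power_fun_simps [simp]: "power_fun n (Fin z) = Fin (z ^ n)" "power_fun n Infty = Infty"
  by (simp_all add: power_fun_def)

lemma power_fun_rotation: "a \<noteq> 0 \<Longrightarrow> power_fun n \<circ> rotation a = rotation (a ^ n) \<circ> power_fun n"
  by (rule ext, case_tac x) (auto simp: power_mult_distrib)

lemma power_fun_comp: "power_fun m \<circ> power_fun n = power_fun (n * m)"
  by (rule ext, case_tac x) (auto simp: power_mult)

lemma surj_power_fun: "n > 0 \<Longrightarrow> surj (power_fun n)"
  unfolding surj_def
proof
  fix y assume n: "n > 0"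
  show "\<exists>x. y = power_fun n x"
  proof (cases y)
    case (Fin w)
    obtain z where "z ^ n = w" using nth_root_exists[OF n] by metis
    then show ?thesis using Fin by (intro exI[of _ "Fin z"]) simp
  next
    case Infty
    then show ?thesis by (intro exI[of _ Infty]) simp
  qed
qed

lemma generic_fibre_card_power_fun:
  assumes "n > 0" shows "generic_fibre_card (power_fun n) n"
  unfolding generic_fibre_card_def
proof (intro exI conjI allI impI)
  show "finite {Fin 0, Infty}" by simp
  fix w assume "w \<notin> {Fin 0, Infty}"
  then obtain c where c: "w = Fin c" "c \<noteq> 0" by (cases w) auto
  have "power_fun n -` {w} = Fin ` {z. z ^ n = c}"
  proof (intro equalityI subsetI)
    fix x assume "x \<in> power_fun n -` {w}"
    then show "x \<in> Fin ` {z. z ^ n = c}" using c by (cases x) auto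
  qed (use c in auto)
  then have "card (power_fun n -` {w}) = card {z. z ^ n = c}"
    by (simp add: card_image inj_on_def)
  then show "card (power_fun n -` {w}) = n"
    using card_nth_roots[of c n] c assms by simp
qed

definition rotations :: "nat \<Rightarrow> (riemann_sphere \<Rightarrow> riemann_sphere) set" where
  "rotations n = rotation ` {a. a ^ n = 1}"

text \<open>
  A deck transformation of \<open>z \<mapsto> z ^ n\<close> fixes \<open>0\<close> and \<open>\<infinity>\<close>, because each of them is its whole
  fibre; so it is a rotation.
\<close>

lemma carrier_Deck_power_fun:
  assumes "n > 0" "inj h"
  shows "carrier (Deck (h \<circ> power_fun n)) = rotations n"
proof (intro equalityI subsetI)
  fix \<mu> assume "\<mu> \<in> carrier (Deck (h \<circ> power_fun n))"
  then have \<mu>: "moebius_map \<mu>" "h \<circ> power_fun n \<circ> \<mu> = h \<circ> power_fun n" by (auto simp: mem_Deck)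
  have eq: "power_fun n (\<mu> x) = power_fun n x" for x
    using fun_cong[OF \<mu>(2), of x] assms(2) by (simp add: inj_eq)
  have "\<mu> (Fin 0) = Fin 0" using eq[of "Fin 0"] assms(1) by (cases "\<mu> (Fin 0)") (auto simp: zero_power)
  moreover have "\<mu> Infty = Infty" using eq[of Infty] by (cases "\<mu> Infty") auto
  ultimately obtain a where a: "\<mu> = rotation a" using moebius_fixing_0_Infty \<mu>(1) by blast
  have "a ^ n = 1" using eq[of "Fin 1"] unfolding a by simp
  then show "\<mu> \<in> rotations n" using a by (auto simp: rotations_def)
next
  fix \<mu> assume "\<mu> \<in> rotations n"
  then obtain a where a: "\<mu> = rotation a" "a ^ n = 1" by (auto simp: rotations_def)
  then have "a \<noteq> 0" using assms(1) by (auto simp: power_0_left)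
  then show "\<mu> \<in> carrier (Deck (h \<circ> power_fun n))"
    using a power_fun_rotation[of a n] by (simp add: mem_Deck moebius_rotation o_assoc[symmetric] rotation_1)
qed

lemma cis_root_of_unity:
  assumes "n > 0" shows "cis (2 * pi / real n) ^ n = 1"
proof -
  have "real n * (2 * pi / real n) = 2 * pi" using assms by simp
  then show ?thesis by (simp only: Complex.DeMoivre cis_2pi)
qed

lemma rotations_iso_integer_mod_group:
  assumes "n > 0"
  shows "comp_group (rotations n) \<cong> integer_mod_group n"
proof -
  define \<omega> where "\<omega> = cis (2 * pi / real n)"
  have \<omega>: "\<omega> ^ n = 1" unfolding \<omega>_def by (rule cis_root_of_unity[OF assms])
  have pow: "\<omega> ^ k = cis (2 * pi * real k / real n)" for k
    by (simp add: \<omega>_def Complex.DeMoivre mult_ac)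
  have mod: "\<omega> ^ (k mod n) = \<omega> ^ k" for k
  proof -
    have "\<omega> ^ k = \<omega> ^ (n * (k div n) + k mod n)" by simp
    also have "\<dots> = (\<omega> ^ n) ^ (k div n) * \<omega> ^ (k mod n)" by (simp only: power_add power_mult)
    finally show ?thesis by (simp add: \<omega>)
  qed
  have "\<omega> \<noteq> 0" by (simp add: \<omega>_def)
  define \<Phi> where "\<Phi> i = rotation (\<omega> ^ nat i)" for i :: int
  have "bij_betw nat {0..<int n} {..<n}"
    by (rule bij_betwI[where g = int]) auto
  moreover have "bij_betw (\<lambda>k. \<omega> ^ k) {..<n} {z. z ^ n = 1}"
    unfolding pow by (rule Complex.bij_betw_roots_unity[OF assms])
  moreover have "bij_betw rotation {z. z ^ n = 1} (rotations n)"
    unfolding rotations_def by (rule inj_on_imp_bij_betw) (auto intro: inj_onI rotation_inject)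
  ultimately have "bij_betw (rotation \<circ> ((\<lambda>k. \<omega> ^ k) \<circ> nat)) {0..<int n} (rotations n)"
    by (intro bij_betw_trans)
  moreover have "rotation \<circ> ((\<lambda>k. \<omega> ^ k) \<circ> nat) = \<Phi>" by (simp add: \<Phi>_def fun_eq_iff)
  ultimately have bij: "bij_betw \<Phi> {0..<int n} (rotations n)" by simp
  have mult: "\<Phi> ((x + y) mod int n) = \<Phi> x \<circ> \<Phi> y" if "0 \<le> x" "0 \<le> y" for x y
  proof -
    have "nat ((x + y) mod int n) = (nat x + nat y) mod n"
      using that by (simp add: nat_mod_distrib nat_add_distrib)
    then show ?thesis using \<open>\<omega> \<noteq> 0\<close> by (simp add: \<Phi>_def mod rotation_comp power_add)
  qed
  have "\<Phi> \<in> iso (integer_mod_group n) (comp_group (rotations n))"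
    using bij mult assms by (auto simp: iso_def hom_def carrier_integer_mod_group bij_betw_def)
  then have "integer_mod_group n \<cong> comp_group (rotations n)" by (rule is_isoI)
  then show ?thesis by (rule group.iso_sym[OF group_integer_mod_group])
qed

text \<open>
  Conjugation by \<open>N\<close> is the isomorphism. The equation \<open>N' \<circ> G \<circ> N \<circ> \<mu> = N' \<circ> G \<circ> N\<close> says that
  \<open>N \<circ> \<mu> \<circ> N'\<close> is a deck transformation of \<open>G\<close>.
\<close>

lemma Deck_conjugate_iso:
  assumes N: "moebius_map N" "moebius_map N'" "N \<circ> N' = id" "N' \<circ> N = id"
  shows "Deck (N' \<circ> G \<circ> N) \<cong> Deck G"
proof -
  have inv: "N (N' x) = x" "N' (N x) = x" for x using N by (simp_all add: fun_eq_iff)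
  define \<Phi> where "\<Phi> \<mu> = N \<circ> \<mu> \<circ> N'" for \<mu>
  have fwd: "\<Phi> \<mu> \<in> carrier (Deck G)" if "\<mu> \<in> carrier (Deck (N' \<circ> G \<circ> N))" for \<mu>
  proof -
    have \<mu>: "moebius_map \<mu>" "N' (G (N (\<mu> x))) = N' (G (N x))" for x
      using that by (auto simp: mem_Deck fun_eq_iff)
    have "G (N (\<mu> x)) = G (N x)" for x using \<mu>(2)[of x] inv(1) by metis
    then show ?thesis using \<mu>(1) N by (auto simp: mem_Deck \<Phi>_def fun_eq_iff inv intro!: moebius_comp)
  qed
  have bwd: "N' \<circ> \<mu> \<circ> N \<in> carrier (Deck (N' \<circ> G \<circ> N))" if "\<mu> \<in> carrier (Deck G)" for \<mu>
    using that N by (auto simp: mem_Deck fun_eq_iff inv intro!: moebius_comp)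
  have "bij_betw \<Phi> (carrier (Deck (N' \<circ> G \<circ> N))) (carrier (Deck G))"
    using fwd bwd by (intro bij_betwI[where g = "\<lambda>\<mu>. N' \<circ> \<mu> \<circ> N"]) (auto simp: \<Phi>_def fun_eq_iff inv)
  moreover have "\<Phi> (\<mu> \<circ> \<nu>) = \<Phi> \<mu> \<circ> \<Phi> \<nu>" for \<mu> \<nu> by (simp add: \<Phi>_def fun_eq_iff inv)
  ultimately have "\<Phi> \<in> iso (Deck (N' \<circ> G \<circ> N)) (Deck G)"
    using fwd by (auto simp: iso_def hom_def Deck_def)
  then show ?thesis by (rule is_isoI)
qed

text \<open>
  The upper bound is proved by induction on the number of iterates, starting from the trivial group
  \<open>Deck (g ^^ 0)\<close>. The rotation by a primitive root of unity belongs to \<open>Deck (g ^^ Suc j)\<close>, which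
  has odd order, and therefore all elements of this group fix \<open>0\<close> and \<open>\<infinity>\<close>. Such an element
  \<open>\<mu>\<close> descends along \<open>g\<close> to \<open>\<nu> \<in> Deck (g ^^ j)\<close>. By the induction hypothesis \<open>\<nu>\<close> fixes
  \<open>0\<close> and \<open>\<infinity>\<close> as well as the critical values of \<open>g\<close>, which are different points.
\<close>

lemma carrier_Deck_iterate:
  assumes d: "d \<ge> 2" "odd d" and h: "moebius_map h" and ne: "h ` {Fin 0, Infty} \<noteq> {Fin 0, Infty}"
    and k: "k \<ge> 1"
  shows "carrier (Deck ((h \<circ> power_fun d) ^^ k)) = rotations d"
proof
  define g where "g = h \<circ> power_fun d"
  have dpos: "d > 0" using d by simp
  have bij: "bij h" by (rule moebius_bij[OF h])
  have Deck_g: "carrier (Deck g) = rotations d"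
    unfolding g_def by (rule carrier_Deck_power_fun[OF dpos bij_is_inj[OF bij]])
  have "surj g" unfolding g_def using bij surj_power_fun[OF dpos] by (intro comp_surj) (auto simp: bij_is_surj)
  have "generic_fibre_card g d"
    using generic_fibre_card_comp[OF generic_fibre_card_bij[OF bij] generic_fibre_card_power_fun[OF dpos]] dpos
    by (simp add: g_def)
  then have generic: "generic_fibre_card (g ^^ j) (d ^ j)" for j
    using generic_fibre_card_funpow dpos by blast
  have contains: "\<rho> \<in> carrier (Deck (g ^^ Suc j))" if \<rho>: "\<rho> \<in> rotations d" for \<rho> j
  proof -
    have "moebius_map \<rho>" "g \<circ> \<rho> = g" using \<rho> Deck_g by (auto simp: mem_Deck)
    then show ?thesis by (simp add: mem_Deck funpow_Suc_right o_assoc[symmetric] del: funpow.simps)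
  qed
  obtain k' where k': "k = Suc k'" using k by (cases k) auto
  show "rotations d \<subseteq> carrier (Deck ((h \<circ> power_fun d) ^^ k))"
    using contains unfolding k' g_def[symmetric] by blast
  define \<omega> where "\<omega> = cis (2 * pi / real d)"
  have \<omega>: "\<omega> ^ d = 1" unfolding \<omega>_def by (rule cis_root_of_unity[OF dpos])
  have "\<omega> \<noteq> 1"
  proof
    assume "\<omega> = 1"
    then have eq: "cis (2 * pi * real 1 / real d) = cis (2 * pi * real 0 / real d)" by (simp add: \<omega>_def)
    have "(1::nat) = 0"
      by (rule inj_onD[OF bij_betw_imp_inj_on[OF Complex.bij_betw_roots_unity[OF dpos]] eq]) (use d in auto)
    then show False by simp
  qed
  have "\<omega> \<noteq> 0" by (simp add: \<omega>_def)
  have \<rho>: "rotation \<omega> \<in> rotations d" using \<omega> by (simp add: rotations_def)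
  have \<rho>_ne: "rotation \<omega> \<noteq> id" using \<open>\<omega> \<noteq> 1\<close> rotation_inject[of \<omega> 1] by (auto simp: rotation_1)
  have "carrier (Deck (g ^^ j)) \<subseteq> rotations d" for j
  proof (induction j)
    case 0
    have "id \<in> rotations d" unfolding rotations_def by (rule image_eqI[of _ _ 1]) (simp_all add: rotation_1)
    moreover have "\<mu> = id" if "\<mu> \<in> carrier (Deck (g ^^ 0))" for \<mu>
      using that by (simp add: mem_Deck)
    ultimately show ?case by blast
  next
    case (Suc j)
    show ?case
    proof
      fix \<mu> assume \<mu>: "\<mu> \<in> carrier (Deck (g ^^ Suc j))"
      have "odd (d ^ Suc j)" using d by simp
      then have fixed: "rotation \<omega> x = x \<Longrightarrow> \<mu> x = x" for x
        using odd_Deck_fixes_special_point[OF generic _ contains[OF \<rho>] \<rho>_ne _ \<mu>] by blast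
      have "\<mu> (Fin 0) = Fin 0" "\<mu> Infty = Infty" using fixed \<open>\<omega> \<noteq> 0\<close> by simp_all
      then obtain a where a: "a \<noteq> 0" "\<mu> = rotation a"
        using moebius_fixing_0_Infty \<mu> by (metis mem_Deck)
      obtain h' where h': "moebius_map h'" "h \<circ> h' = id" "h' \<circ> h = id"
        using moebius_inverse h by blast
      have hh: "h (h' x) = x" "h' (h x) = x" for x using h' by (simp_all add: fun_eq_iff)
      \<comment> \<open>\<open>z \<mapsto> z ^ d\<close> turns the rotation by \<open>a\<close> into the rotation by \<open>a ^ d\<close>.\<close>
      define \<nu> where "\<nu> = h \<circ> rotation (a ^ d) \<circ> h'"
      have g\<mu>: "g (\<mu> x) = \<nu> (g x)" for x
        using fun_cong[OF power_fun_rotation[OF a(1), of d], of x] by (simp add: g_def a(2) \<nu>_def hh)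
      have "moebius_map \<nu>"
        unfolding \<nu>_def using a(1) by (intro moebius_comp h h' moebius_rotation) simp
      moreover have "g ^^ j \<circ> \<nu> = g ^^ j"
      proof
        fix y
        obtain x where x: "y = g x" using \<open>surj g\<close> by blast
        have "(g ^^ Suc j) (\<mu> x) = (g ^^ Suc j) x"
          using \<mu> by (metis mem_Deck comp_apply)
        then show "(g ^^ j \<circ> \<nu>) y = (g ^^ j) y"
          unfolding x by (simp add: funpow_swap1[symmetric] funpow_Suc_right g\<mu> del: funpow.simps)
      qed
      ultimately have "\<nu> \<in> carrier (Deck (g ^^ j))" by (simp add: mem_Deck)
      then obtain b where b: "\<nu> = rotation b" "b ^ d = 1" using Suc.IH by (auto simp: rotations_def)
      then have "b \<noteq> 0" using dpos by (auto simp: power_0_left)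
      have fix4: "\<nu> (Fin 0) = Fin 0" "\<nu> Infty = Infty" "\<nu> (h (Fin 0)) = h (Fin 0)" "\<nu> (h Infty) = h Infty"
      proof -
        show "\<nu> (Fin 0) = Fin 0" "\<nu> Infty = Infty" using \<open>b \<noteq> 0\<close> by (simp_all add: b(1))
        have "a ^ d \<noteq> 0" using a(1) by simp
        then show "\<nu> (h (Fin 0)) = h (Fin 0)" "\<nu> (h Infty) = h Infty" by (simp_all add: \<nu>_def hh)
      qed
      obtain y where y: "\<nu> y = y" "y \<noteq> Fin 0" "y \<noteq> Infty"
      proof -
        have "h (Fin 0) \<noteq> h Infty" using bij by (simp add: bij_is_inj inj_eq)
        then have "h (Fin 0) \<notin> {Fin 0, Infty} \<or> h Infty \<notin> {Fin 0, Infty}"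
          using ne by auto
        then show ?thesis using that fix4 by blast
      qed
      have "\<nu> = id"
        using moebius_three_fixed_points[of \<nu> "Fin 0" Infty y] \<open>moebius_map \<nu>\<close> fix4 y by auto
      then have "g \<circ> \<mu> = g" using g\<mu> by (auto simp: fun_eq_iff)
      then have "\<mu> \<in> carrier (Deck g)" using \<mu> by (simp add: mem_Deck)
      then show "\<mu> \<in> rotations d" using Deck_g by blast
    qed
  qed
  then show "carrier (Deck ((h \<circ> power_fun d) ^^ k)) \<subseteq> rotations d" unfolding g_def by blast
qed

text \<open>
  A Moebius map that preserves \<open>{0, \<infinity>}\<close> is \<open>z \<mapsto> a z\<close> or \<open>z \<mapsto> 1 / (a z)\<close>, and both
  rotations and \<open>z \<mapsto> 1 / z\<close> descend along \<open>z \<mapsto> z ^ d\<close>.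
\<close>

lemma power_fun_moebius_semiconjugate:
  assumes h: "moebius_map h" "h ` {Fin 0, Infty} = {Fin 0, Infty}" and d: "d > 0"
  obtains h' where "moebius_map h'" "power_fun d \<circ> h = h' \<circ> power_fun d"
proof (cases "h Infty = Infty")
  case True
  moreover have "h (Fin 0) = Fin 0"
  proof -
    have "h (Fin 0) \<noteq> h Infty" using moebius_bij[OF h(1)] by (simp add: bij_is_inj inj_eq)
    then show ?thesis using True h(2) by auto
  qed
  ultimately obtain a where "a \<noteq> 0" "h = rotation a" using moebius_fixing_0_Infty h(1) by metis
  then show ?thesis using that[of "rotation (a ^ d)"] power_fun_rotation moebius_rotation by simp
next
  case False
  define \<iota> where "\<iota> = moeb 0 1 1 0"
  have \<iota>: "moebius_map \<iota>" unfolding \<iota>_def by (rule moebius_moeb) simp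
  have \<iota>_vals: "\<iota> Infty = Fin 0" "\<iota> (Fin z) = (if z = 0 then Infty else Fin (1 / z))" for z
    by (simp_all add: \<iota>_def moeb_def proj_def)
  have invol: "\<iota> (\<iota> x) = x" for x by (cases x) (simp_all add: \<iota>_vals)
  have \<iota>_power: "power_fun d (\<iota> x) = \<iota> (power_fun d x)" for x
    using d by (cases x) (simp_all add: \<iota>_vals power_divide)
  have "h Infty \<in> {Fin 0, Infty}" using h(2) by blast
  then have "h Infty = Fin 0" using False by blast
  moreover have "Infty \<in> h ` {Fin 0, Infty}" unfolding h(2) by simp
  then have "h (Fin 0) = Infty" using False by fastforce
  ultimately have "(\<iota> \<circ> h) (Fin 0) = Fin 0" "(\<iota> \<circ> h) Infty = Infty" by (simp_all add: \<iota>_vals)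
  then obtain a where a: "a \<noteq> 0" "\<iota> \<circ> h = rotation a"
    by (rule moebius_fixing_0_Infty[OF moebius_comp[OF \<iota> h(1)]])
  have "power_fun d (h x) = \<iota> (rotation (a ^ d) (power_fun d x))" for x
  proof -
    have "h x = \<iota> (rotation a x)" using fun_cong[OF a(2), of x] invol by (metis comp_apply)
    then show ?thesis using fun_cong[OF power_fun_rotation[OF a(1), of d], of x] by (simp add: \<iota>_power)
  qed
  then have "power_fun d \<circ> h = (\<iota> \<circ> rotation (a ^ d)) \<circ> power_fun d" by (simp add: fun_eq_iff)
  then show ?thesis using that moebius_comp[OF \<iota> moebius_rotation, of "a ^ d"] a by simp
qed

text \<open>
  Pulling the inner \<open>h\<close> through the power exhibits the second iterate as a Moebius map after
  \<open>z \<mapsto> z ^ (d * d)\<close>.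
\<close>

lemma carrier_Deck_power_map_square:
  assumes h: "moebius_map h" "h ` {Fin 0, Infty} = {Fin 0, Infty}" and d: "d > 0"
  shows "carrier (Deck ((h \<circ> power_fun d) ^^ 2)) = rotations (d * d)"
proof -
  obtain h' where h': "moebius_map h'" "power_fun d \<circ> h = h' \<circ> power_fun d"
    using power_fun_moebius_semiconjugate assms by blast
  have "(h \<circ> power_fun d) ^^ 2 = h \<circ> (power_fun d \<circ> h) \<circ> power_fun d"
    by (simp add: numeral_2_eq_2 o_assoc)
  also have "\<dots> = (h \<circ> h') \<circ> (power_fun d \<circ> power_fun d)" unfolding h'(2) by (simp only: o_assoc)
  finally have "(h \<circ> power_fun d) ^^ 2 = (h \<circ> h') \<circ> power_fun (d * d)" by (simp only: power_fun_comp)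
  moreover have "inj (h \<circ> h')" using moebius_comp[OF h(1) h'(1)] moebius_bij bij_is_inj by blast
  ultimately show ?thesis using carrier_Deck_power_fun[of "d * d" "h \<circ> h'"] d by simp
qed

lemma integer_mod_group_iso_imp_eq:
  assumes "integer_mod_group m \<cong> integer_mod_group n" "m > 0" "n > 0"
  shows "m = n"
  using iso_same_card[OF assms(1)] assms(2,3) by (simp add: carrier_integer_mod_group)

theorem theorem1:
  fixes f :: "riemann_sphere \<Rightarrow> riemann_sphere" and d :: nat
  assumes "bicritical f"
    and "rational_degree f = d"
    and "odd d"
  shows "((\<forall>k\<ge>1. Deck (f ^^ k) \<cong> integer_mod_group d) \<longleftrightarrow> \<not> power_map f) \<and>
         (power_map f \<longleftrightarrow> (\<exists>k\<ge>1. \<exists>n>d. Deck (f ^^ k) \<cong> integer_mod_group n))"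
proof -
  obtain M N x1 x2 where M: "moebius_map M" and N: "moebius_map N" and f: "f = M \<circ> power_fun d \<circ> N"
    and crit: "critical_points f = {x1, x2}" and x: "N x1 = Fin 0" "N x2 = Infty" and d: "d \<ge> 2"
    using bicritical_normal_form[OF assms(1,2)] .
  obtain N' where N': "moebius_map N'" "N \<circ> N' = id" "N' \<circ> N = id"
    using moebius_inverse[OF N] .
  have NN: "N' (N y) = y" for y using N'(3) by (simp add: fun_eq_iff)
  define h where "h = N \<circ> M"
  define g where "g = h \<circ> power_fun d"
  have h: "moebius_map h" unfolding h_def by (rule moebius_comp[OF N M])
  have dpos: "d > 0" using d by simp
  have f_conj: "f = N' \<circ> g \<circ> N" by (simp add: f g_def h_def fun_eq_iff NN)
  have iterate: "f ^^ k = N' \<circ> g ^^ k \<circ> N" for k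
  proof -
    have "f ^^ k = f ^^ k \<circ> N' \<circ> N" by (simp add: o_assoc[symmetric] N'(3))
    also have "f ^^ k \<circ> N' = N' \<circ> g ^^ k" unfolding f_conj by (rule conj_funpow[OF N'(2)])
    finally show ?thesis .
  qed
  have Deck_iso: "Deck (f ^^ k) \<cong> integer_mod_group n"
    if "carrier (Deck (g ^^ k)) = rotations n" "n > 0" for k n
  proof -
    have "Deck (f ^^ k) \<cong> Deck (g ^^ k)" unfolding iterate by (rule Deck_conjugate_iso[OF N N'])
    also have "Deck (g ^^ k) = comp_group (rotations n)" using Deck_eq_comp_group[of "g ^^ k"] that(1) by simp
    also have "\<dots> \<cong> integer_mod_group n" by (rule rotations_iso_integer_mod_group[OF that(2)])
    finally show ?thesis .
  qed
  have power_map_iff: "power_map f \<longleftrightarrow> h ` {Fin 0, Infty} = {Fin 0, Infty}"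
  proof -
    have "N ` critical_points f = {Fin 0, Infty}" by (simp add: crit x)
    moreover have "N ` critical_values f = h ` {Fin 0, Infty}"
      unfolding critical_values_def crit using dpos by (simp add: f x h_def zero_power)
    moreover have "power_map f \<longleftrightarrow> critical_points f = critical_values f"
      using assms(1) by (simp add: power_map_def)
    ultimately show ?thesis
      using inj_image_eq_iff[OF bij_is_inj[OF moebius_bij[OF N]]] by metis
  qed
  have iso_unique: "n = m"
    if "Deck (f ^^ k) \<cong> integer_mod_group m" "Deck (f ^^ k) \<cong> integer_mod_group n" "m > 0" "n > 0" for k m n
    using integer_mod_group_iso_imp_eq[of n m] iso_trans[OF group.iso_sym[OF group_Deck that(2)] that(1)] that(3,4)
    by blast
  show ?thesis
  proof (cases "power_map f")
    case True
    then have two: "Deck (f ^^ 2) \<cong> integer_mod_group (d * d)"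
      using Deck_iso[of 2 "d * d"] carrier_Deck_power_map_square[OF h _ dpos] dpos
      by (simp add: power_map_iff g_def)
    have big: "d * d > d" using d by simp
    then have "\<not> Deck (f ^^ 2) \<cong> integer_mod_group d" using iso_unique[OF two] dpos by force
    moreover have "(1::nat) \<le> 2" by simp
    ultimately show ?thesis using True two big by blast
  next
    case False
    then have all: "Deck (f ^^ k) \<cong> integer_mod_group d" if "k \<ge> 1" for k
      using Deck_iso[of k d] carrier_Deck_iterate[OF d assms(3) h _ that] dpos
      by (simp add: power_map_iff g_def)
    have "n = d" if "k \<ge> 1" "n > d" "Deck (f ^^ k) \<cong> integer_mod_group n" for k n
      using iso_unique[OF all[OF that(1)] that(3)] that(2) dpos by simp
    then show ?thesis using False all by blast
  qed
qed

end
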